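(* Let $n_1<n_2<\cdots$ be positive integers of the form $n_k=2^{m_k}$, $m_k\in\mathbb{N}$ ($m_k\ge 1$), satisfying $$n_k^{1/8}\ge 2^{n_1+\dots+n_{k-1}},\qquad k=2,3,\dots,$$ and put $N_0=0$, $N_k=n_1+\dots+n_k$, $\alpha_k=2^{n_k}n_k^{-5/4}$. There exist sets $J^k\subset\{1,\dots,2^{N_k}\}$ with $\mathrm{card}\,J^k=n_k$, $k=1,2,\dots$, such that: (a) for each $k$, the intervals $\Delta^j_{N_k}$, $j\in J^k$, are all contained in one dyadic interval of rank $N_{k-1}$; (b) for each $k$, the $n_k\times n_k$ matrix $n_k^{-1/2}\big(\varepsilon^{N_k}_{ij}\big)_{N_{k-1}<i\le N_k,\ j\in J^k}$ is orthogonal; (c) the sets $B_k=\bigcup_{j\in J^k}\Delta^j_{N_k}$, $k=1,2,\dots$, are pairwise disjoint (up to sets of measure zero); and the function $f=\sum_{k=1}^\infty\alpha_k\chi_{B_k}$ belongs to $\mathcal{M}(L_1)$ but does not belong to the symmetric kernel $\mathrm{Sym}(L_1)$, that is, $$\int_0^1 f^*(t)\log^{1/2}(e/t)\,dt=\infty.$$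
   Context: $L_1=L_1[0,1]$; $m$ is Lebesgue measure; $\chi_B$ is the characteristic function of $B$. $\Delta_n^j=[(j-1)2^{-n},j2^{-n}]$, $j=1,\dots,2^n$, are the dyadic intervals of rank $n$. Rademacher functions: $r_i(t)=\mathrm{sign}\,\sin(2^i\pi t)$, $t\in[0,1]$, $i\ge1$. For $i\le n$, $\varepsilon_{ij}^n\in\{-1,1\}$ denotes the (constant) value of $r_i$ on the interior of $\Delta_n^j$. $f^*$ is the decreasing rearrangement of $|f|$; $f,g$ are equimeasurable if $m\{|f|>\tau\}=m\{|g|>\tau\}$ for all $\tau>0$. $\mathcal{M}(L_1)$, the Rademacher multiplicator space of $L_1$, consists of all measurable $f:[0,1]\to\mathbb{R}$ such that $f\cdot\sum_{k=1}^\infty a_kr_k\in L_1$ for every Rademacher sum $\sum_{k=1}^\infty a_kr_k\in L_1$ (equivalently, for every $(a_k)\in\ell_2$), with norm $\|f\|_{\mathcal{M}(L_1)}=\sup\{\|f\sum a_kr_k\|_1:\|\sum a_kr_k\|_1\le1\}$. $\mathrm{Sym}(L_1)$ consists of all $f\in\mathcal{M}(L_1)$ such that every $g$ equimeasurable with $f$ also belongs to $\mathcal{M}(L_1)$. *)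

theory Defs
  imports "HOL-Analysis.Analysis"
begin

abbreviation m01 :: "real measure" where
  "m01 \<equiv> lebesgue_on {0..1}"

definition dyadic :: "nat \<Rightarrow> nat \<Rightarrow> real set" where
  "dyadic n j = {(real j - 1) / 2 ^ n .. real j / 2 ^ n}"

definition rademacher :: "nat \<Rightarrow> real \<Rightarrow> real" where
  "rademacher i t = sgn (sin (2 ^ i * pi * t))"

(* The description is proper for i \<le> n and 1 \<le> j \<le> 2^n, the only case of interest. *)
definition rademacher_sign :: "nat \<Rightarrow> nat \<Rightarrow> nat \<Rightarrow> real" where
  "rademacher_sign n i j = (THE c. \<forall>t \<in> interior (dyadic n j). rademacher i t = c)"

(* x is (a version of) the sum of the series a_1 r_1 + a_2 r_2 + ..., an element of L_1.
   Convergence is in the norm of L_1; by Khintchine's inequality this is the same as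
   convergence almost everywhere, and as square summability of a. *)
definition rademacher_sum_L1 :: "(nat \<Rightarrow> real) \<Rightarrow> (real \<Rightarrow> real) \<Rightarrow> bool" where
  "rademacher_sum_L1 a x \<longleftrightarrow> integrable m01 x \<and>
     (\<lambda>n. \<integral>t. \<bar>x t - (\<Sum>k=1..n. a k * rademacher k t)\<bar> \<partial>m01) \<longlonglongrightarrow> 0"

(* Functions are not identified almost everywhere, but all sets of functions below are
   invariant under changes on null sets; values outside [0,1] are irrelevant. *)
definition mult_L1 :: "(real \<Rightarrow> real) set" where
  "mult_L1 = {f \<in> borel_measurable m01.
     \<forall>a x. rademacher_sum_L1 a x \<longrightarrow> integrable m01 (\<lambda>t. f t * x t)}"

definition equimeasurable :: "(real \<Rightarrow> real) \<Rightarrow> (real \<Rightarrow> real) \<Rightarrow> bool" where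
  "equimeasurable f g \<longleftrightarrow> f \<in> borel_measurable m01 \<and> g \<in> borel_measurable m01 \<and>
     (\<forall>\<tau>>0. measure m01 {t \<in> {0..1}. \<bar>f t\<bar> > \<tau>} = measure m01 {t \<in> {0..1}. \<bar>g t\<bar> > \<tau>})"

definition sym_L1 :: "(real \<Rightarrow> real) set" where
  "sym_L1 = {f \<in> mult_L1. \<forall>g. equimeasurable f g \<longrightarrow> g \<in> mult_L1}"

(* For measurable f and t > 0 the infimum is over a nonempty set. *)
definition decr_rearr :: "(real \<Rightarrow> real) \<Rightarrow> real \<Rightarrow> real" where
  "decr_rearr f t = Inf {\<tau>. 0 \<le> \<tau> \<and> measure m01 {s \<in> {0..1}. \<bar>f s\<bar> > \<tau>} \<le> t}"

(* Orthogonality, as in orthogonal_matrix, of a matrix with rows I and columns J; an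
   explicit version is needed as the index sets depend on a natural number. *)
definition orthogonal_matrix_on ::
    "'i set \<Rightarrow> 'j set \<Rightarrow> ('i \<Rightarrow> 'j \<Rightarrow> real) \<Rightarrow> bool" where
  "orthogonal_matrix_on I J A \<longleftrightarrow> finite I \<and> finite J \<and> card I = card J \<and>
     (\<forall>j\<in>J. \<forall>j'\<in>J. (\<Sum>i\<in>I. A i j * A i j') = (if j = j' then 1 else 0)) \<and>
     (\<forall>i\<in>I. \<forall>i'\<in>I. (\<Sum>j\<in>J. A i j * A i' j) = (if i = i' then 1 else 0))"

end

theory Submission imports Defs begin

text \<open>
  The columns of the Sylvester--Hadamard matrix \<open>walsh m\<close> are realised as sign patterns of
  dyadic intervals inside the rightmost dyadic interval of rank \<open>N (k - 1)\<close>. The first row of this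
  matrix is constant, so these intervals lie in the left half, which leaves the rightmost dyadic
  interval of rank \<open>N k\<close> free for the next step; hence the sets \<open>B k\<close> are disjoint.

  Membership in the multiplicator space: on \<open>B k\<close> the square of a Rademacher sum has mean at most
  \<open>2 N (k - 1) + 3\<close> times the squared \<open>\<ell>\<^sub>2\<close> norm, by orthogonality, while
  \<open>\<alpha> k\<close> times the measure of \<open>B k\<close> is at most \<open>8 ^ (- N (k - 1))\<close>.

  Failure of symmetry: the measure of \<open>B k\<close> is that of a single dyadic interval \<open>D k\<close>, which
  can be chosen so that all Rademacher functions of the block that are constant on \<open>D k\<close> equal 1
  there. Replacing \<open>B k\<close> by \<open>D k\<close> and integrating against \<open>\<Sum>i. i powr (- 3/5) * r\<^sub>i\<close> gives
  contributions of order at least \<open>n k powr (1/40)\<close>.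
\<close>

subsection \<open>Rademacher functions on dyadic intervals\<close>

text \<open>The argument of the sine lies strictly between \<open>pi * q\<close> and
  \<open>pi * (q + 1)\<close>, where the sine has the sign of \<open>cos (pi * q)\<close>.\<close>

lemma rademacher_eq:
  assumes "real q / 2 ^ i < t" "t < (real q + 1) / 2 ^ i"
  shows "rademacher i t = (- 1) ^ q"
proof -
  define y where "y = 2 ^ i * pi * t - pi * real q"
  have "real q < 2 ^ i * t" "2 ^ i * t < real q + 1"
    using assms by (simp_all add: field_simps)
  then have "pi * real q < pi * (2 ^ i * t)" "pi * (2 ^ i * t) < pi * (real q + 1)"
    using mult_strict_left_mono[OF _ pi_gt_zero] by blast+
  then have "0 < y" "y < pi"
    by (simp_all add: y_def algebra_simps)
  then have "sin y > 0" by (rule sin_gt_zero)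
  moreover have "sin (2 ^ i * pi * t) = sin (y + pi * real q)"
    by (simp add: y_def)
  then have "sin (2 ^ i * pi * t) = sin y * (- 1) ^ q"
    by (simp add: sin_add sin_npi2 cos_npi2)
  ultimately show ?thesis
    by (cases "even q") (simp_all add: rademacher_def)
qed

lemma rademacher_le_1: "\<bar>rademacher i t\<bar> \<le> 1"
  by (simp add: rademacher_def abs_sgn_eq)

lemma borel_measurable_rademacher [measurable]: "rademacher i \<in> borel_measurable borel"
  unfolding rademacher_def by measurable

lemma interior_dyadic:
  "interior (dyadic n j) = {(real j - 1) / 2 ^ n<..<real j / 2 ^ n}"
  unfolding dyadic_def by simp

text \<open>Counting from 0, the rank \<open>n\<close> interval number \<open>j - 1\<close> lies in
  the rank \<open>i\<close> interval number \<open>(j - 1) div 2 ^ (n - i)\<close>. For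
  \<open>1 \<le> i\<close> and \<open>j \<le> 2 ^ n\<close> the parity of that number is the
  \<open>i\<close>-th of the \<open>n\<close> binary digits of \<open>j - 1\<close>, read from the
  most significant one.\<close>

lemma rademacher_on_dyadic:
  assumes "i \<le> n" "1 \<le> j" "t \<in> interior (dyadic n j)"
  shows "rademacher i t = (- 1) ^ ((j - 1) div 2 ^ (n - i))"
proof (rule rademacher_eq)
  define d :: nat where "d = 2 ^ (n - i)"
  define q where "q = (j - 1) div d"
  have d: "d > 0" by (simp add: d_def)
  have pow: "(2::real) ^ n = 2 ^ i * real d"
    using assms(1) by (simp add: d_def flip: power_add)
  have j: "(real j - 1) / 2 ^ n < t" "t < real j / 2 ^ n"
    using assms(3) by (auto simp: interior_dyadic)
  have "q * d \<le> j - 1" by (simp add: q_def)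
  then have "real (q * d) \<le> real (j - 1)" by (rule of_nat_mono)
  then have "real q * real d \<le> real j - 1" using assms(2) by (simp add: of_nat_diff)
  then have "real q / 2 ^ i \<le> (real j - 1) / 2 ^ n"
    using d by (simp add: pow field_simps)
  with j(1) show "real ((j - 1) div 2 ^ (n - i)) / 2 ^ i < t"
    by (simp add: q_def d_def)
  have "j - 1 < (q + 1) * d"
    using dividend_less_times_div[OF d, of "j - 1"] by (simp add: q_def mult.commute)
  then have "j \<le> (q + 1) * d" by linarith
  then have "real j \<le> real ((q + 1) * d)" by (rule of_nat_mono)
  then have "real j \<le> (real q + 1) * real d" by (simp add: algebra_simps)
  then have "real j / 2 ^ n \<le> (real q + 1) / 2 ^ i"
    using d by (simp add: pow field_simps)
  with j(2) show "t < (real ((j - 1) div 2 ^ (n - i)) + 1) / 2 ^ i"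
    by (simp add: q_def d_def)
qed

lemma rademacher_sign_eq:
  assumes "i \<le> n" "1 \<le> j"
  shows "rademacher_sign n i j = (- 1) ^ ((j - 1) div 2 ^ (n - i))"
  unfolding rademacher_sign_def
proof (rule the_equality)
  show "\<forall>t\<in>interior (dyadic n j). rademacher i t = (- 1) ^ ((j - 1) div 2 ^ (n - i))"
    using rademacher_on_dyadic[OF assms] by blast
next
  fix c assume c: "\<forall>t\<in>interior (dyadic n j). rademacher i t = c"
  \<comment> \<open>The midpoint witnesses that the interior is nonempty, which makes the described
    value unique.\<close>
  have "(real j - 1/2) / 2 ^ n \<in> interior (dyadic n j)"
    by (simp add: interior_dyadic divide_strict_right_mono)
  then show "c = (- 1) ^ ((j - 1) div 2 ^ (n - i))"
    using c rademacher_on_dyadic[OF assms] by metis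
qed

lemma abs_rademacher_sign:
  assumes "i \<le> n" "1 \<le> j" shows "\<bar>rademacher_sign n i j\<bar> = 1"
  by (simp add: rademacher_sign_eq[OF assms] power_abs)

text \<open>The expectation of \<open>\<Phi> (c \<plusminus> a (n+1) \<plusminus> \<dots> \<plusminus> a (n+p))\<close> over independent fair signs.\<close>

fun sign_avg :: "(nat \<Rightarrow> real) \<Rightarrow> (real \<Rightarrow> real) \<Rightarrow> nat \<Rightarrow> nat \<Rightarrow> real \<Rightarrow> real" where
  "sign_avg a \<Phi> n 0 c = \<Phi> c"
| "sign_avg a \<Phi> n (Suc p) c =
    (sign_avg a \<Phi> (Suc n) p (c + a (Suc n)) + sign_avg a \<Phi> (Suc n) p (c - a (Suc n))) / 2"

text \<open>Induction on \<open>p\<close>: the interval splits into its halves of rank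
  \<open>Suc n\<close>, on which the next Rademacher function is 1 and -1. The value
  \<open>c\<close> collects the terms whose signs are already fixed.\<close>

lemma has_integral_dyadic:
  assumes "1 \<le> j"
  shows "((\<lambda>t. \<Phi> (c + (\<Sum>i=Suc n..n+p. a i * rademacher i t)))
           has_integral (sign_avg a \<Phi> n p c / 2 ^ n)) (dyadic n j)"
  using assms
proof (induction p arbitrary: n j c)
  case 0
  show ?case
    using has_integral_const_real[of "\<Phi> c" "(real j - 1) / 2 ^ n" "real j / 2 ^ n"]
    by (simp add: dyadic_def divide_right_mono field_simps)
next
  case (Suc p)
  have split: "(\<Sum>i=Suc n..n + Suc p. a i * rademacher i t) =
      a (Suc n) * rademacher (Suc n) t + (\<Sum>i=Suc (Suc n)..Suc n + p. a i * rademacher i t)" for t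
    by (simp add: sum.atLeast_Suc_atMost)
  let ?F = "\<lambda>t. \<Phi> (c + (\<Sum>i=Suc n..n + Suc p. a i * rademacher i t))"
  have half: "(?F has_integral (sign_avg a \<Phi> (Suc n) p (c + s * a (Suc n)) / 2 ^ Suc n)) (dyadic (Suc n) l)"
    if l: "1 \<le> l" "(- 1) ^ (l - 1) = s" for l s
  proof -
    let ?G = "\<lambda>t. \<Phi> ((c + s * a (Suc n)) + (\<Sum>i=Suc (Suc n)..Suc n + p. a i * rademacher i t))"
    have G: "(?G has_integral (sign_avg a \<Phi> (Suc n) p (c + s * a (Suc n)) / 2 ^ Suc n)) (dyadic (Suc n) l)"
      by (rule Suc.IH[OF l(1)])
    \<comment> \<open>At the endpoints Rademacher functions vanish, so the two integrands are
      compared in the interior only.\<close>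
    show ?thesis unfolding dyadic_def box_real(2)[symmetric]
    proof (rule has_integral_spike_interior)
      show "(?G has_integral (sign_avg a \<Phi> (Suc n) p (c + s * a (Suc n)) / 2 ^ Suc n))
        (cbox ((real l - 1) / 2 ^ Suc n) (real l / 2 ^ Suc n))"
        using G by (simp add: dyadic_def)
      fix t assume "t \<in> box ((real l - 1) / 2 ^ Suc n) (real l / 2 ^ Suc n)"
      then have "t \<in> interior (dyadic (Suc n) l)" by (auto simp: interior_dyadic)
      then have "rademacher (Suc n) t = s"
        using rademacher_on_dyadic[of "Suc n" "Suc n" l t] l by simp
      then show "?F t = ?G t" by (simp only: split) (simp add: add.assoc mult.commute)
    qed
  qed
  \<comment> \<open>The left half has number \<open>2 * j - 1\<close> and the right half
    \<open>2 * j\<close>; the parity of the number minus one gives the sign.\<close>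
  have "2 * j - 1 - 1 = 2 * (j - 1)" by simp
  then have even: "(- 1 :: real) ^ (2 * j - 1 - 1) = 1" by (simp only: power_mult) simp
  have 1: "(?F has_integral (sign_avg a \<Phi> (Suc n) p (c + a (Suc n)) / 2 ^ Suc n)) (dyadic (Suc n) (2 * j - 1))"
    using half[of "2 * j - 1" 1] Suc.prems even by simp
  have 2: "(?F has_integral (sign_avg a \<Phi> (Suc n) p (c - a (Suc n)) / 2 ^ Suc n)) (dyadic (Suc n) (2 * j))"
    using half[of "2 * j" "-1"] Suc.prems by (simp add: uminus_power_if)
  have r: "real (2 * j - 1) = 2 * real j - 1" using Suc.prems by (simp add: of_nat_diff)
  have d1: "dyadic (Suc n) (2 * j - 1) = {(real j - 1) / 2 ^ n .. (real j - 1/2) / 2 ^ n}"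
    and d2: "dyadic (Suc n) (2 * j) = {(real j - 1/2) / 2 ^ n .. real j / 2 ^ n}"
    unfolding dyadic_def r by (simp_all add: field_simps)
  show ?case
    unfolding dyadic_def
    using has_integral_combine[OF _ _ 1[unfolded d1] 2[unfolded d2]]
    by (simp add: divide_right_mono field_simps)
qed

lemma sign_avg_id: "sign_avg a (\<lambda>u. u) n p c = c"
  by (induction p arbitrary: n c) (simp_all add: field_simps)

lemma sign_avg_square: "sign_avg a (\<lambda>u. u\<^sup>2) n p c = c\<^sup>2 + (\<Sum>i=Suc n..n+p. (a i)\<^sup>2)"
proof (induction p arbitrary: n c)
  case (Suc p)
  have "(\<Sum>i=Suc n..n + Suc p. (a i)\<^sup>2) = (a (Suc n))\<^sup>2 + (\<Sum>i=Suc (Suc n)..Suc n + p. (a i)\<^sup>2)"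
    by (simp add: sum.atLeast_Suc_atMost)
  then show ?case by (simp add: Suc.IH) (simp add: power2_eq_square field_simps)
qed simp

text \<open>The right-hand side is the fourth moment of a Gaussian variable with mean
  \<open>c\<close> and variance \<open>s n p a\<close>. Keeping \<open>c\<close> general makes the
  induction work; each step gives away \<open>2 * b ^ 4\<close>.\<close>

lemma sign_avg_power4:
  fixes s defines "s \<equiv> \<lambda>n p a. (\<Sum>i=Suc n..n+p. (a i :: real)\<^sup>2)"
  shows "sign_avg a (\<lambda>u. u ^ 4) n p c \<le> c ^ 4 + 6 * c\<^sup>2 * s n p a + 3 * (s n p a)\<^sup>2"
proof (induction p arbitrary: n c)
  case (Suc p)
  define b v where "b = a (Suc n)" and "v = s (Suc n) p a"
  have s: "s n (Suc p) a = b\<^sup>2 + v"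
    by (simp add: s_def b_def v_def sum.atLeast_Suc_atMost)
  have "sign_avg a (\<lambda>u. u ^ 4) n (Suc p) c \<le>
      (((c + b) ^ 4 + 6 * (c + b)\<^sup>2 * v + 3 * v\<^sup>2) + ((c - b) ^ 4 + 6 * (c - b)\<^sup>2 * v + 3 * v\<^sup>2)) / 2"
    using add_mono[OF Suc.IH[of "Suc n" "c + b"] Suc.IH[of "Suc n" "c - b"]]
    by (simp add: b_def v_def)
  also have "\<dots> = c ^ 4 + 6 * c\<^sup>2 * (b\<^sup>2 + v) + 3 * (b\<^sup>2 + v)\<^sup>2 - 2 * b ^ 4"
    by (simp add: power2_eq_square power4_eq_xxxx algebra_simps)
  also have "\<dots> \<le> c ^ 4 + 6 * c\<^sup>2 * (b\<^sup>2 + v) + 3 * (b\<^sup>2 + v)\<^sup>2" by simp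
  finally show ?case by (simp only: s)
qed (simp add: s_def)

subsection \<open>Rademacher sums in $L_1$\<close>

definition rad_sum :: "(nat \<Rightarrow> real) \<Rightarrow> nat \<Rightarrow> real \<Rightarrow> real" where
  "rad_sum a m t = (\<Sum>k=1..m. a k * rademacher k t)"

lemma borel_measurable_rad_sum [measurable]: "rad_sum a m \<in> borel_measurable borel"
  unfolding rad_sum_def by measurable

lemma abs_rad_sum_le: "\<bar>rad_sum a m t\<bar> \<le> (\<Sum>k=1..m. \<bar>a k\<bar>)"
  unfolding rad_sum_def
proof (rule order_trans[OF sum_abs], rule sum_mono)
  fix k show "\<bar>a k * rademacher k t\<bar> \<le> \<bar>a k\<bar>"
    using mult_left_mono[OF rademacher_le_1, of "\<bar>a k\<bar>" k t] by (simp add: abs_mult)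
qed

text \<open>In the interior of the interval the first \<open>n\<close> Rademacher functions are
  constant, so their part of the sum becomes the starting value of the average over the remaining
  \<open>m - n\<close> signs.\<close>

lemma has_integral_rad_sum_dyadic:
  assumes "1 \<le> j" "n \<le> m"
  shows "((\<lambda>t. \<Phi> (rad_sum a m t)) has_integral
     (sign_avg a \<Phi> n (m - n) (\<Sum>i=1..n. a i * rademacher_sign n i j) / 2 ^ n)) (dyadic n j)"
  unfolding dyadic_def box_real(2)[symmetric]
proof (rule has_integral_spike_interior)
  define c where "c = (\<Sum>i=1..n. a i * rademacher_sign n i j)"
  show "((\<lambda>t. \<Phi> (c + (\<Sum>i=Suc n..n + (m - n). a i * rademacher i t))) has_integral
      (sign_avg a \<Phi> n (m - n) (\<Sum>i=1..n. a i * rademacher_sign n i j) / 2 ^ n))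
      (cbox ((real j - 1) / 2 ^ n) (real j / 2 ^ n))"
    unfolding c_def box_real(2) dyadic_def[symmetric]
    by (rule has_integral_dyadic[OF assms(1)])
  fix t assume "t \<in> box ((real j - 1) / 2 ^ n) (real j / 2 ^ n)"
  then have t: "t \<in> interior (dyadic n j)" by (auto simp: interior_dyadic)
  have "c = (\<Sum>i=1..n. a i * rademacher i t)"
    unfolding c_def by (rule sum.cong) (use assms(1) in \<open>auto simp: rademacher_sign_eq rademacher_on_dyadic[OF _ _ t]\<close>)
  moreover have "{1..m} = {1..n} \<union> {Suc n..m}" "{1..n} \<inter> {Suc n..m} = {}"
    using assms(2) by auto
  ultimately have "rad_sum a m t = c + (\<Sum>i=Suc n..m. a i * rademacher i t)"
    by (simp add: rad_sum_def sum.union_disjoint)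
  then show "\<Phi> (rad_sum a m t) = \<Phi> (c + (\<Sum>i=Suc n..n + (m - n). a i * rademacher i t))"
    using assms(2) by simp
qed

section \<open>Lebesgue integrals and norms of Rademacher sums over the unit interval\<close>

lemma finite_measure_m01: "finite_measure m01"
  by (rule finite_measure_lebesgue_on) simp

lemma dyadic_0_1: "dyadic 0 (Suc 0) = {0..1}"
  by (simp add: dyadic_def)

text \<open>Passage from gauge integrals to Lebesgue integrals: a bounded measurable function is
  integrable for a finite measure, and then the two integrals agree.\<close>

lemma lebesgue_integral_m01_eqI:
  fixes F :: "real \<Rightarrow> real"
  assumes F: "F \<in> borel_measurable borel" and C: "\<And>t. \<bar>F t\<bar> \<le> C"
    and B: "B \<in> sets borel" "B \<subseteq> {0..1}" and I: "(F has_integral I) B"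
  shows "integrable m01 (\<lambda>t. indicator B t * F t)" (is ?A)
    and "(\<integral>t. indicator B t * F t \<partial>m01) = I" (is ?B)
proof -
  interpret finite_measure m01 by (rule finite_measure_m01)
  have "(\<lambda>t. indicator B t * F t) \<in> borel_measurable borel"
    using F B by measurable
  then have meas: "(\<lambda>t. indicator B t * F t) \<in> borel_measurable m01"
    by (intro measurable_restrict_space1 measurable_completion) simp
  have "C \<ge> 0" using C[of 0] by linarith
  with C have "norm (indicator B t * F t) \<le> C" for t
    by (auto simp: indicator_def)
  then show ?A by (intro integrable_const_bound[where B=C] meas) auto
  then have "(\<integral>t. indicator B t * F t \<partial>m01) = integral {0..1} (\<lambda>t. indicator B t * F t)"
    by (intro lebesgue_integral_eq_integral) auto
  moreover have "(\<lambda>t. indicator B t * F t) = (\<lambda>t. if t \<in> B then F t else 0)"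
    by (auto simp: indicator_def)
  moreover have "integral {0..1} (\<lambda>t. if t \<in> B then F t else 0) = I"
    using I B(2) by (intro integral_unique) simp
  ultimately show ?B by simp
qed

lemma bounded_continuous_rad_sum:
  fixes \<Phi> :: "real \<Rightarrow> real"
  assumes "continuous_on UNIV \<Phi>"
  obtains C where "\<And>t. \<bar>\<Phi> (rad_sum a m t)\<bar> \<le> C"
proof -
  define K where "K = (\<Sum>k=1..m. \<bar>a k\<bar>)"
  have "compact (\<Phi> ` {-K..K})"
    by (intro compact_continuous_image continuous_on_subset[OF assms]) auto
  then obtain C where C: "\<And>y. y \<in> \<Phi> ` {-K..K} \<Longrightarrow> norm y \<le> C"
    using compact_imp_bounded bounded_iff by metis
  have "rad_sum a m t \<in> {-K..K}" for t
    using abs_rad_sum_le[of a m t] by (auto simp: K_def)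
  then have "\<bar>\<Phi> (rad_sum a m t)\<bar> \<le> C" for t
    using C by fastforce
  then show ?thesis by (rule that)
qed

lemma rad_sum_integral:
  fixes \<Phi> :: "real \<Rightarrow> real"
  assumes "continuous_on UNIV \<Phi>" "B \<in> sets borel" "B \<subseteq> {0..1}"
    and "((\<lambda>t. \<Phi> (rad_sum a m t)) has_integral I) B"
  shows "integrable m01 (\<lambda>t. indicator B t * \<Phi> (rad_sum a m t))"
    and "(\<integral>t. indicator B t * \<Phi> (rad_sum a m t) \<partial>m01) = I"
proof -
  obtain C where C: "\<And>t. \<bar>\<Phi> (rad_sum a m t)\<bar> \<le> C"
    using bounded_continuous_rad_sum[OF assms(1)] by metis
  have "\<Phi> \<in> borel_measurable borel"
    using assms(1) by (rule borel_measurable_continuous_onI)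
  then have meas: "(\<lambda>t. \<Phi> (rad_sum a m t)) \<in> borel_measurable borel"
    by measurable
  show "integrable m01 (\<lambda>t. indicator B t * \<Phi> (rad_sum a m t))"
    and "(\<integral>t. indicator B t * \<Phi> (rad_sum a m t) \<partial>m01) = I"
    using lebesgue_integral_m01_eqI[OF meas C assms(2-4)] by auto
qed

lemma rad_sum_integral_m01:
  fixes \<Phi> :: "real \<Rightarrow> real"
  assumes "continuous_on UNIV \<Phi>"
  shows "integrable m01 (\<lambda>t. \<Phi> (rad_sum a m t))" (is ?A)
    and "(\<integral>t. \<Phi> (rad_sum a m t) \<partial>m01) = sign_avg a \<Phi> 0 m 0" (is ?B)
proof -
  have I: "((\<lambda>t. \<Phi> (rad_sum a m t)) has_integral sign_avg a \<Phi> 0 m 0) {0..1}"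
    using has_integral_rad_sum_dyadic[of 1 0 m \<Phi> a] by (simp add: dyadic_0_1)
  note R = rad_sum_integral[OF assms _ _ I]
  have "integrable m01 (\<lambda>t. \<Phi> (rad_sum a m t)) \<longleftrightarrow>
      integrable m01 (\<lambda>t. indicator {0..1} t * \<Phi> (rad_sum a m t))"
    by (rule Bochner_Integration.integrable_cong) auto
  with R(1) show ?A by simp
  have "(\<integral>t. \<Phi> (rad_sum a m t) \<partial>m01) = (\<integral>t. indicator {0..1} t * \<Phi> (rad_sum a m t) \<partial>m01)"
    by (rule Bochner_Integration.integral_cong) auto
  with R(2) show ?B by simp
qed

text \<open>Second and fourth moments suffice: the pointwise inequality
  \<open>l * u\<^sup>2 - l ^ 3 / 4 * u ^ 4 \<le> \<bar>u\<bar>\<close> is integrated, and the fourth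
  moment is at most \<open>3 * s\<^sup>2\<close>.\<close>

lemma Khintchine_L1_lower:
  "sqrt (\<Sum>i=1..m. (a i)\<^sup>2) / 4 \<le> (\<integral>t. \<bar>rad_sum a m t\<bar> \<partial>m01)"
proof -
  define s where "s = (\<Sum>i=1..m. (a i)\<^sup>2)"
  have "s \<ge> 0" by (simp add: s_def sum_nonneg)
  show ?thesis
  proof (cases "s = 0")
    case True
    then show ?thesis by (simp add: s_def)
  next
    case False
    \<comment> \<open>With \<open>l\<^sup>2 * s = 1\<close> the lower bound
      \<open>l * s - l ^ 3 / 4 * (3 * s\<^sup>2)\<close> becomes \<open>sqrt s / 4\<close>.\<close>
    define l where "l = 1 / sqrt s"
    have l: "l > 0" "l\<^sup>2 * s = 1" "l * s = sqrt s"
      using False \<open>s \<ge> 0\<close> by (auto simp: l_def power_divide real_div_sqrt)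
    have int2: "integrable m01 (\<lambda>t. (rad_sum a m t)\<^sup>2)"
      and int4: "integrable m01 (\<lambda>t. (rad_sum a m t) ^ 4)"
      and int1: "integrable m01 (\<lambda>t. \<bar>rad_sum a m t\<bar>)"
      by (auto intro!: rad_sum_integral_m01(1) continuous_intros)
    have sq: "(\<integral>t. (rad_sum a m t)\<^sup>2 \<partial>m01) = s"
      using rad_sum_integral_m01(2)[of "\<lambda>u. u\<^sup>2" a m]
      by (simp add: sign_avg_square s_def continuous_intros)
    have p4: "(\<integral>t. (rad_sum a m t) ^ 4 \<partial>m01) \<le> 3 * s\<^sup>2"
      using rad_sum_integral_m01(2)[of "\<lambda>u. u ^ 4" a m] sign_avg_power4[of a 0 m 0]
      by (simp add: s_def continuous_intros)
    have "sqrt s / 4 = l * s - l ^ 3 / 4 * (3 * s\<^sup>2)"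
    proof -
      have "l ^ 3 * s\<^sup>2 = (l\<^sup>2 * s) * (l * s)" by (simp add: power2_eq_square power3_eq_cube)
      then show ?thesis using l by simp
    qed
    also have "\<dots> \<le> l * s - l ^ 3 / 4 * (\<integral>t. (rad_sum a m t) ^ 4 \<partial>m01)"
      using mult_left_mono[OF p4, of "l ^ 3 / 4"] l by simp
    also have "\<dots> = (\<integral>t. l * (rad_sum a m t)\<^sup>2 - l ^ 3 / 4 * (rad_sum a m t) ^ 4 \<partial>m01)"
      using int2 int4 by (simp add: sq)
    also have "\<dots> \<le> (\<integral>t. \<bar>rad_sum a m t\<bar> \<partial>m01)"
    proof (rule integral_mono)
      fix t
      define u where "u = \<bar>rad_sum a m t\<bar>"
      have u: "u \<ge> 0" by (simp add: u_def)
      define v where "v = l * u"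
      have "v \<ge> 0" using l u by (simp add: v_def)
      have "0 \<le> 1 + v ^ 3 / 4 - v"
      proof -
        \<comment> \<open>A cubic with a double root at 6/5, a rational number near the minimiser
          \<open>sqrt (4/3)\<close> of \<open>1 + v ^ 3 / 4 - v\<close>.\<close>
        have "0 \<le> (5 * v - 6)\<^sup>2 * (5 * v + 12)" using \<open>v \<ge> 0\<close> by simp
        also have "\<dots> = 125 * v ^ 3 - 540 * v + 432"
          by (simp add: power2_eq_square power3_eq_cube algebra_simps)
        finally show ?thesis using \<open>v \<ge> 0\<close> by linarith
      qed
      then have "0 \<le> u * (1 + v ^ 3 / 4 - v)" using u by simp
      then have "l * u\<^sup>2 - l ^ 3 / 4 * u ^ 4 \<le> u"
        by (simp add: v_def power2_eq_square power3_eq_cube power4_eq_xxxx algebra_simps)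
      then show "l * (rad_sum a m t)\<^sup>2 - l ^ 3 / 4 * (rad_sum a m t) ^ 4 \<le> \<bar>rad_sum a m t\<bar>"
        by (simp add: u_def)
    qed (use int1 int2 int4 in auto)
    finally show ?thesis by (simp add: s_def)
  qed
qed

text \<open>The inequality of arithmetic and geometric means. Integrated with \<open>l\<close> a
  bound for the L2 norm, it bounds the L1 norm by \<open>l\<close> in place of
  Cauchy-Schwarz.\<close>

lemma abs_le_square: "\<bar>u\<bar> \<le> (u\<^sup>2 / l + l) / 2" if "l > 0" for u l :: real
proof -
  have "0 \<le> (\<bar>u\<bar> - l)\<^sup>2" by simp
  then have "2 * l * \<bar>u\<bar> \<le> u\<^sup>2 + l\<^sup>2" by (simp add: power2_diff algebra_simps)
  then show ?thesis using that by (simp add: field_simps power2_eq_square)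
qed

lemma rad_sum_L1_upper:
  assumes "(\<Sum>i=1..m. (a i)\<^sup>2) \<le> l\<^sup>2" "l > 0"
  shows "(\<integral>t. \<bar>rad_sum a m t\<bar> \<partial>m01) \<le> l"
proof -
  have int2: "integrable m01 (\<lambda>t. (rad_sum a m t)\<^sup>2)"
    and int1: "integrable m01 (\<lambda>t. \<bar>rad_sum a m t\<bar>)"
    by (auto intro!: rad_sum_integral_m01(1) continuous_intros)
  have one: "integrable m01 (\<lambda>t. c :: real)" for c
    by (intro finite_measure.integrable_const finite_measure_m01)
  have "measure m01 (space m01) = 1" by (simp add: measure_restrict_space)
  have "(\<integral>t. \<bar>rad_sum a m t\<bar> \<partial>m01) \<le> (\<integral>t. ((rad_sum a m t)\<^sup>2 / l + l) / 2 \<partial>m01)"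
    by (rule integral_mono) (use int1 int2 one abs_le_square[OF assms(2)] in auto)
  also have "\<dots> = ((\<integral>t. (rad_sum a m t)\<^sup>2 \<partial>m01) / l + l) / 2"
    using int2 one \<open>measure m01 (space m01) = 1\<close> by simp
  also have "(\<integral>t. (rad_sum a m t)\<^sup>2 \<partial>m01) = (\<Sum>i=1..m. (a i)\<^sup>2)"
    using rad_sum_integral_m01(2)[of "\<lambda>u. u\<^sup>2" a m]
    by (simp add: sign_avg_square continuous_intros)
  also have "((\<Sum>i=1..m. (a i)\<^sup>2) / l + l) / 2 \<le> (l\<^sup>2 / l + l) / 2"
    using assms by (intro divide_right_mono add_mono) auto
  finally show ?thesis using assms(2) by (simp add: power2_eq_square)
qed

text \<open>The Riesz-Fischer argument: a subsequence converges almost everywhere, and Fatou's lemma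
  bounds the distance of its limit from every late \<open>s j\<close>.\<close>

lemma L1_complete:
  fixes s :: "nat \<Rightarrow> 'a \<Rightarrow> real"
  assumes int: "\<And>n. integrable M (s n)"
      and cauchy: "\<And>e. e > 0 \<Longrightarrow> \<exists>N. \<forall>i\<ge>N. \<forall>j\<ge>N. (\<integral>t. \<bar>s i t - s j t\<bar> \<partial>M) < e"
  obtains x where "integrable M x" "(\<lambda>n. \<integral>t. \<bar>x t - s n t\<bar> \<partial>M) \<longlonglongrightarrow> 0"
proof -
  obtain r where r: "strict_mono r" "AE t in M. Cauchy (\<lambda>i. s (r i) t)"
    using cauchy_L1_AE_cauchy_subseq[of M s, OF int, unfolded real_norm_def, OF cauchy] by blast
  define x where "x = (\<lambda>t. lim (\<lambda>i. s (r i) t))"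
  have [measurable]: "s n \<in> borel_measurable M" for n using int by auto
  have xmeas [measurable]: "x \<in> borel_measurable M"
    unfolding x_def by measurable
  have lim: "AE t in M. (\<lambda>i. s (r i) t) \<longlonglongrightarrow> x t"
    using r(2) by eventually_elim (simp add: x_def Cauchy_convergent_iff convergent_LIMSEQ_iff)
  have fatou: "(\<integral>\<^sup>+t. ennreal \<bar>x t - s j t\<bar> \<partial>M) \<le> ennreal e"
    if N: "\<forall>i\<ge>N. \<forall>j\<ge>N. (\<integral>t. \<bar>s i t - s j t\<bar> \<partial>M) < e" "j \<ge> N" "e > 0" for N j e
  proof -
    have "AE t in M. ennreal \<bar>x t - s j t\<bar> = liminf (\<lambda>i. ennreal \<bar>s (r i) t - s j t\<bar>)"
      using lim
    proof eventually_elim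
      fix t assume "(\<lambda>i. s (r i) t) \<longlonglongrightarrow> x t"
      then have "(\<lambda>i. ennreal \<bar>s (r i) t - s j t\<bar>) \<longlonglongrightarrow> ennreal \<bar>x t - s j t\<bar>"
        by (intro tendsto_intros) auto
      then show "ennreal \<bar>x t - s j t\<bar> = liminf (\<lambda>i. ennreal \<bar>s (r i) t - s j t\<bar>)"
        by (rule lim_imp_Liminf[OF trivial_limit_sequentially, symmetric])
    qed
    then have "(\<integral>\<^sup>+t. ennreal \<bar>x t - s j t\<bar> \<partial>M) = (\<integral>\<^sup>+t. liminf (\<lambda>i. ennreal \<bar>s (r i) t - s j t\<bar>) \<partial>M)"
      by (rule nn_integral_cong_AE)
    also have "\<dots> \<le> liminf (\<lambda>i. \<integral>\<^sup>+t. ennreal \<bar>s (r i) t - s j t\<bar> \<partial>M)"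
      by (rule nn_integral_liminf) measurable
    also have "\<dots> \<le> liminf (\<lambda>i. ennreal e)"
    proof (rule Liminf_mono)
      show "\<forall>\<^sub>F i in sequentially. (\<integral>\<^sup>+t. ennreal \<bar>s (r i) t - s j t\<bar> \<partial>M) \<le> ennreal e"
        using eventually_ge_at_top[of N]
      proof eventually_elim
        fix i assume "N \<le> i"
        then have "N \<le> r i" using seq_suble[OF r(1), of i] by linarith
        then have "(\<integral>t. \<bar>s (r i) t - s j t\<bar> \<partial>M) < e" using N by blast
        moreover have "(\<integral>\<^sup>+t. ennreal \<bar>s (r i) t - s j t\<bar> \<partial>M) = ennreal (\<integral>t. \<bar>s (r i) t - s j t\<bar> \<partial>M)"
          using int by (intro nn_integral_eq_integral) auto
        ultimately show "(\<integral>\<^sup>+t. ennreal \<bar>s (r i) t - s j t\<bar> \<partial>M) \<le> ennreal e"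
          by (simp add: ennreal_leI)
      qed
    qed
    also have "\<dots> = ennreal e" by (simp add: Liminf_const)
    finally show ?thesis .
  qed
  have diff: "integrable M (\<lambda>t. x t - s j t)" if "(\<integral>\<^sup>+t. ennreal \<bar>x t - s j t\<bar> \<partial>M) \<le> ennreal e" for j e
    using that by (intro integrableI_bounded) (auto simp: le_less_trans)
  show ?thesis
  proof (rule that)
    \<comment> \<open>One integrable difference \<open>x - s N\<close> suffices for the
      integrability of \<open>x\<close>.\<close>
    obtain N where "\<forall>i\<ge>N. \<forall>j\<ge>N. (\<integral>t. \<bar>s i t - s j t\<bar> \<partial>M) < 1" using cauchy[of 1] by auto
    then have "integrable M (\<lambda>t. x t - s N t)" by (intro diff[OF fatou]) auto
    then have "integrable M (\<lambda>t. (x t - s N t) + s N t)" by (intro Bochner_Integration.integrable_add int)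
    then show xint: "integrable M x" by simp
    show "(\<lambda>n. \<integral>t. \<bar>x t - s n t\<bar> \<partial>M) \<longlonglongrightarrow> 0"
    proof (rule LIMSEQ_I)
      fix e :: real assume "e > 0"
      then obtain N where N: "\<forall>i\<ge>N. \<forall>j\<ge>N. (\<integral>t. \<bar>s i t - s j t\<bar> \<partial>M) < e / 2" using cauchy[of "e/2"] by auto
      have "norm ((\<integral>t. \<bar>x t - s n t\<bar> \<partial>M) - 0) < e" if "n \<ge> N" for n
      proof -
        have "ennreal (\<integral>t. \<bar>x t - s n t\<bar> \<partial>M) = (\<integral>\<^sup>+t. ennreal \<bar>x t - s n t\<bar> \<partial>M)"
          using int xint by (intro nn_integral_eq_integral[symmetric]) auto
        also have "\<dots> \<le> ennreal (e / 2)" using fatou[OF N that] \<open>e > 0\<close> by simp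
        finally have "(\<integral>t. \<bar>x t - s n t\<bar> \<partial>M) \<le> e / 2" using \<open>e > 0\<close> by (simp add: ennreal_le_iff)
        then show ?thesis using \<open>e > 0\<close> by simp
      qed
      then show "\<exists>no. \<forall>n\<ge>no. norm ((\<integral>t. \<bar>x t - s n t\<bar> \<partial>M) - 0) < e" by blast
    qed
  qed
qed

text \<open>A difference of two partial sums is the Rademacher sum over a stretch of coefficients,
  so its L1 norm is at most the l2 norm of that stretch; completeness of L1 then provides the
  limit.\<close>

lemma rademacher_sum_L1_exists:
  assumes "summable (\<lambda>i. (a i)\<^sup>2)"
  obtains x where "rademacher_sum_L1 a x"
proof -
  have "\<exists>N. \<forall>i\<ge>N. \<forall>j\<ge>N. (\<integral>t. \<bar>rad_sum a i t - rad_sum a j t\<bar> \<partial>m01) < e" if "e > 0" for e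
  proof -
    \<comment> \<open>The half turns the non-strict norm bound of \<open>rad_sum_L1_upper\<close>
      into a strict one by \<open>e\<close>.\<close>
    have "\<exists>N. \<forall>m\<ge>N. \<forall>n. norm (sum (\<lambda>i. (a i)\<^sup>2) {m..<n}) < (e / 2)\<^sup>2"
      using that assms[unfolded summable_Cauchy] by simp
    then obtain N where N: "\<And>m n. m \<ge> N \<Longrightarrow> norm (sum (\<lambda>i. (a i)\<^sup>2) {m..<n}) < (e / 2)\<^sup>2"
      by blast
    have bound: "(\<integral>t. \<bar>rad_sum a i t - rad_sum a j t\<bar> \<partial>m01) < e" if "N \<le> j" "j \<le> i" for i j
    proof -
      define b where "b = (\<lambda>k. if k \<le> j then 0 else a k)"
      have "rad_sum a i t - rad_sum a j t = rad_sum b i t" for t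
      proof -
        have *: "{1..i} = {1..j} \<union> {j<..i}" "{1..j} \<inter> {j<..i} = {}" using that by auto
        then show ?thesis by (simp add: rad_sum_def b_def sum.union_disjoint)
      qed
      moreover have "(\<Sum>k=1..i. (b k)\<^sup>2) = (\<Sum>k=Suc j..<Suc i. (a k)\<^sup>2)"
        by (rule sum.mono_neutral_cong_right) (auto simp: b_def)
      then have "(\<Sum>k=1..i. (b k)\<^sup>2) \<le> (e / 2)\<^sup>2"
        using N[of "Suc j" "Suc i"] that by simp
      then have "(\<integral>t. \<bar>rad_sum b i t\<bar> \<partial>m01) \<le> e / 2"
        using \<open>e > 0\<close> by (intro rad_sum_L1_upper) auto
      ultimately show ?thesis using \<open>e > 0\<close> by simp
    qed
    have "(\<integral>t. \<bar>rad_sum a i t - rad_sum a j t\<bar> \<partial>m01) < e" if "N \<le> i" "N \<le> j" for i j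
      using bound[of j i] bound[of i j] that by (cases "i \<le> j") (auto simp: abs_minus_commute)
    then show ?thesis by blast
  qed
  moreover have "integrable m01 (rad_sum a n)" for n
    using rad_sum_integral_m01(1)[of "\<lambda>u. u" a n] by (simp add: continuous_intros)
  ultimately obtain x where "integrable m01 x" "(\<lambda>n. \<integral>t. \<bar>x t - rad_sum a n t\<bar> \<partial>m01) \<longlonglongrightarrow> 0"
    using L1_complete[of m01 "rad_sum a"] by blast
  then show ?thesis
    by (intro that[of x]) (simp add: rademacher_sum_L1_def rad_sum_def)
qed

text \<open>Convergence in L1 bounds the L1 norms of the late partial sums, and Khintchine's lower
  inequality turns this into a bound for the coefficients.\<close>

lemma rademacher_sum_L1_square_bounded:
  assumes "rademacher_sum_L1 a x"
  obtains K where "K \<ge> 0" "\<And>m. (\<Sum>i=1..m. (a i)\<^sup>2) \<le> K"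
proof -
  have x: "integrable m01 x" and lim: "(\<lambda>n. \<integral>t. \<bar>x t - rad_sum a n t\<bar> \<partial>m01) \<longlonglongrightarrow> 0"
    using assms by (auto simp: rademacher_sum_L1_def rad_sum_def)
  have int: "integrable m01 (rad_sum a n)" for n
    using rad_sum_integral_m01(1)[of "\<lambda>u. u" a n] by (simp add: continuous_intros)
  have "\<forall>\<^sub>F n in sequentially. (\<integral>t. \<bar>x t - rad_sum a n t\<bar> \<partial>m01) < 1"
    using order_tendstoD(2)[OF lim, of 1] by simp
  then obtain N where N: "\<And>n. n \<ge> N \<Longrightarrow> (\<integral>t. \<bar>x t - rad_sum a n t\<bar> \<partial>m01) < 1"
    by (auto simp: eventually_sequentially)
  define C where "C = (\<integral>t. \<bar>x t\<bar> \<partial>m01) + 1"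
  have "C \<ge> 0" by (simp add: C_def)
  have big: "(\<Sum>i=1..n. (a i)\<^sup>2) \<le> (4 * C)\<^sup>2" if "n \<ge> N" for n
  proof -
    have "sqrt (\<Sum>i=1..n. (a i)\<^sup>2) / 4 \<le> (\<integral>t. \<bar>rad_sum a n t\<bar> \<partial>m01)"
      by (rule Khintchine_L1_lower)
    also have "\<dots> \<le> (\<integral>t. \<bar>x t\<bar> + \<bar>x t - rad_sum a n t\<bar> \<partial>m01)"
      using int x by (intro integral_mono) auto
    also have "\<dots> = (\<integral>t. \<bar>x t\<bar> \<partial>m01) + (\<integral>t. \<bar>x t - rad_sum a n t\<bar> \<partial>m01)"
      using int x by (intro Bochner_Integration.integral_add) auto
    also have "\<dots> \<le> C" using N[OF that] by (simp add: C_def)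
    finally show ?thesis using sqrt_le_D by fastforce
  qed
  \<comment> \<open>The sums of squares increase with \<open>m\<close>, so a late one bounds the
    early ones.\<close>
  have "(\<Sum>i=1..m. (a i)\<^sup>2) \<le> (4 * C)\<^sup>2" for m
    using sum_mono2[of "{1..max m N}" "{1..m}" "\<lambda>i. (a i)\<^sup>2"] big[of "max m N"] by auto
  then show ?thesis using that[of "(4 * C)\<^sup>2"] by auto
qed

subsection \<open>Hadamard matrices of Rademacher signs\<close>

text \<open>The entry is -1 to the number of positions, among the \<open>m\<close> lowest binary
  digits, at which both \<open>p\<close> and \<open>q\<close> have the digit 1; the recursion peels
  off the lowest digit.\<close>

fun walsh :: "nat \<Rightarrow> nat \<Rightarrow> nat \<Rightarrow> real" where
  "walsh 0 p q = 1"
| "walsh (Suc m) p q = (if odd p \<and> odd q then - 1 else 1) * walsh m (p div 2) (q div 2)"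

lemma walsh_commute: "walsh m p q = walsh m q p"
  by (induction m arbitrary: p q) (auto simp: conj_commute)

lemma walsh_pm1: "walsh m p q = 1 \<or> walsh m p q = - 1"
  by (induction m arbitrary: p q) auto

lemma walsh_0: "walsh m 0 q = 1"
  by (induction m arbitrary: q) auto

lemma sum_even_odd: "(\<Sum>p<2 * n. g p) = (\<Sum>p<n. g (2 * p) + g (2 * p + 1))"
  for g :: "nat \<Rightarrow> real"
  by (induction n) auto

text \<open>Summing over the lowest digit of \<open>p\<close> leaves the factor
  \<open>1 + s q * s q'\<close>, which vanishes if the lowest digits of \<open>q\<close> and
  \<open>q'\<close> differ and is 2 otherwise; the higher digits are left to the induction
  hypothesis.\<close>

lemma walsh_orthogonal:
  "q < 2 ^ m \<Longrightarrow> q' < 2 ^ m \<Longrightarrow> (\<Sum>p<2 ^ m. walsh m p q * walsh m p q') = (if q = q' then 2 ^ m else 0)"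
proof (induction m arbitrary: q q')
  case (Suc m)
  define s where "s q = (if odd q then - 1 else 1 :: real)" for q :: nat
  have "(\<Sum>p<2 ^ Suc m. walsh (Suc m) p q * walsh (Suc m) p q') =
     (\<Sum>p<2 ^ m. (1 + s q * s q') * (walsh m p (q div 2) * walsh m p (q' div 2)))"
    unfolding power_Suc sum_even_odd by (rule sum.cong) (auto simp: s_def algebra_simps)
  also have "\<dots> = (1 + s q * s q') * (if q div 2 = q' div 2 then 2 ^ m else 0)"
    using Suc.IH[of "q div 2" "q' div 2"] Suc.prems by (simp add: sum_distrib_left[symmetric] less_mult_imp_div_less)
  also have "\<dots> = (if q = q' then 2 ^ Suc m else 0)"
  proof (cases "q = q'")
    case False
    have "odd q \<noteq> odd q'" if "q div 2 = q' div 2"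
      using that False by (metis bit_eq_rec)
    with False show ?thesis by (auto simp: s_def)
  qed (simp add: s_def)
  finally show ?case .
qed auto

text \<open>As the Rademacher signs of a dyadic interval are binary digits of its number, this lets
  a pattern of \<open>n\<close> signs be prescribed. Position 0 is the most significant
  digit.\<close>

lemma exists_nat_with_binary_digits:
  fixes b :: "nat \<Rightarrow> bool"
  shows "\<exists>c<(2::nat) ^ n. \<forall>p<n. odd (c div 2 ^ (n - 1 - p)) = b p"
proof (induction n)
  case (Suc n)
  then obtain c :: nat where c: "c < 2 ^ n" "\<And>p. p < n \<Longrightarrow> odd (c div 2 ^ (n - 1 - p)) = b p" by blast
  define c' where "c' = 2 * c + of_bool (b n)"
  have "c' < 2 ^ Suc n" using c(1) by (simp add: c'_def)
  moreover have "odd (c' div 2 ^ (Suc n - 1 - p)) = b p" if "p < Suc n" for p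
  proof (cases "p = n")
    case False
    then have "Suc n - 1 - p = Suc (n - 1 - p)" "p < n" using that by auto
    moreover have "c' div 2 = c" by (simp add: c'_def)
    ultimately show ?thesis using c(2)[of p] by (simp only: power_Suc div_mult2_eq)
  qed (simp add: c'_def)
  ultimately show ?case by blast
qed simp

text \<open>Parseval's identity: after expanding the square and summing over \<open>j\<close> first,
  orthogonality of the rows removes the mixed products.\<close>

lemma sum_orthogonal_square:
  assumes "orthogonal_matrix_on I J A"
  shows "(\<Sum>j\<in>J. (\<Sum>i\<in>I. a i * A i j)\<^sup>2) = (\<Sum>i\<in>I. (a i)\<^sup>2)"
proof -
  have fin: "finite I" "finite J" and orth: "\<And>i i'. i \<in> I \<Longrightarrow> i' \<in> I \<Longrightarrow> (\<Sum>j\<in>J. A i j * A i' j) = (if i = i' then 1 else 0)"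
    using assms by (auto simp: orthogonal_matrix_on_def)
  have "(\<Sum>j\<in>J. (\<Sum>i\<in>I. a i * A i j)\<^sup>2) = (\<Sum>j\<in>J. \<Sum>i\<in>I. \<Sum>i'\<in>I. a i * a i' * (A i j * A i' j))"
    by (simp add: power2_eq_square sum_product mult_ac)
  also have "\<dots> = (\<Sum>i\<in>I. \<Sum>j\<in>J. \<Sum>i'\<in>I. a i * a i' * (A i j * A i' j))"
    by (rule sum.swap)
  also have "\<dots> = (\<Sum>i\<in>I. \<Sum>i'\<in>I. \<Sum>j\<in>J. a i * a i' * (A i j * A i' j))"
    by (intro sum.cong refl sum.swap)
  also have "\<dots> = (\<Sum>i\<in>I. \<Sum>i'\<in>I. a i * a i' * (if i = i' then 1 else 0))"
    by (intro sum.cong refl) (simp add: sum_distrib_left[symmetric] orth)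
  also have "\<dots> = (\<Sum>i\<in>I. (a i)\<^sup>2)"
    using fin by (simp add: power2_eq_square if_distrib cong: if_cong)
  finally show ?thesis .
qed

text \<open>Column \<open>q\<close> of the Walsh matrix supplies the lowest \<open>n\<close> binary
  digits of an interval's number (from 0). The \<open>N\<close> digits before them are all 1, which
  places the interval in the rightmost one of rank \<open>N\<close>.\<close>

lemma Hadamard_dyadic_columns:
  fixes N m :: nat
  defines "n \<equiv> 2 ^ m"
  obtains J where "J \<subseteq> {1..2 ^ (N + n)}" "card J = n"
    "\<And>j. j \<in> J \<Longrightarrow> dyadic (N + n) j \<subseteq> {1 - 1 / 2 ^ N .. 1 - 1 / 2 ^ N / 2}"
    "orthogonal_matrix_on {N<..N + n} J (\<lambda>i j. real n powr (- 1/2) * rademacher_sign (N + n) i j)"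
proof -
  have "\<forall>q. \<exists>c<(2::nat) ^ n. \<forall>p<n. odd (c div 2 ^ (n - 1 - p)) = (walsh m p q = - 1)"
    by (intro allI exists_nat_with_binary_digits)
  then obtain c :: "nat \<Rightarrow> nat" where c: "\<And>q. c q < 2 ^ n"
      "\<And>p q. p < n \<Longrightarrow> odd (c q div 2 ^ (n - 1 - p)) = (walsh m p q = - 1)"
    by metis
  have npos: "n > 0" by (simp add: n_def)
  \<comment> \<open>Row 0 of the Walsh matrix is constantly 1, so the leading digit of
    \<open>c q\<close> is 0.\<close>
  have c_half: "c q < 2 ^ (n - 1)" for q
  proof (rule ccontr)
    assume "\<not> ?thesis"
    moreover have pow: "(2::nat) ^ n = 2 * 2 ^ (n - 1)" using npos by (simp flip: power_Suc)
    ultimately have "c q div 2 ^ (n - 1) = 1"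
      using c(1)[of q] by (intro div_nat_eqI) auto
    then show False using c(2)[of 0 q] npos by (simp add: walsh_0)
  qed
  \<comment> \<open>The offset \<open>2 ^ n * (2 ^ N - 1)\<close> counts the intervals to the left
    of the rightmost one of rank \<open>N\<close>; the final 1 is there because dyadic intervals are
    numbered from 1.\<close>
  define \<beta> where "\<beta> q = 2 ^ n * (2 ^ N - 1) + c q + 1" for q
  define J where "J = \<beta> ` {..<n}"
  have sgn: "rademacher_sign (N + n) (N + 1 + p) (\<beta> q) = walsh m p q" if "p < n" for p q
  proof -
    have "rademacher_sign (N + n) (N + 1 + p) (\<beta> q) = (- 1) ^ ((\<beta> q - 1) div 2 ^ (N + n - (N + 1 + p)))"
      using that by (intro rademacher_sign_eq) (auto simp: \<beta>_def)
    \<comment> \<open>After the division the offset contributes an even number, so only digit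
      \<open>p\<close> of \<open>c q\<close> decides the sign.\<close>
    also have "\<beta> q - 1 = c q + 2 ^ (n - 1 - p) * (2 ^ Suc p * (2 ^ N - 1))"
      using that by (simp add: \<beta>_def mult.assoc[symmetric] del: power_Suc flip: power_add)
    also have "N + n - (N + 1 + p) = n - 1 - p" by simp
    also have "(c q + 2 ^ (n - 1 - p) * (2 ^ Suc p * (2 ^ N - 1))) div 2 ^ (n - 1 - p)
        = 2 * (2 ^ p * (2 ^ N - 1)) + c q div 2 ^ (n - 1 - p)"
      by simp
    also have "(- 1 :: real) ^ \<dots> = (- 1) ^ (c q div 2 ^ (n - 1 - p))"
      by (simp add: power_add power_mult)
    also have "\<dots> = walsh m p q"
      using c(2)[OF that, of q] walsh_pm1[of m p q] by (cases "odd (c q div 2 ^ (n - 1 - p))") auto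
    finally show ?thesis .
  qed
  \<comment> \<open>Equal values of \<open>\<beta>\<close> would give equal columns, whose inner
    product would be \<open>n\<close> instead of 0.\<close>
  have inj: "inj_on \<beta> {..<n}"
  proof (rule inj_onI, rule ccontr)
    fix q q' assume q: "q \<in> {..<n}" "q' \<in> {..<n}" "\<beta> q = \<beta> q'" "q \<noteq> q'"
    then have "walsh m p q = walsh m p q'" if "p < n" for p
      using sgn[OF that, of q] sgn[OF that, of q'] by simp
    then have "(\<Sum>p<n. walsh m p q * walsh m p q') = (\<Sum>p<n. walsh m p q * walsh m p q)" by simp
    then show False using q walsh_orthogonal[of q m q'] walsh_orthogonal[of q m q] by (simp add: n_def)
  qed
  have rows: "{N<..N + n} = (\<lambda>p. N + 1 + p) ` {..<n}"
  proof
    show "{N<..N + n} \<subseteq> (\<lambda>p. N + 1 + p) ` {..<n}"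
    proof
      fix i assume "i \<in> {N<..N + n}"
      then have "i = N + 1 + (i - Suc N)" "i - Suc N \<in> {..<n}" by auto
      then show "i \<in> (\<lambda>p. N + 1 + p) ` {..<n}" by blast
    qed
  qed auto
  have inj_rows: "inj_on (\<lambda>p. N + 1 + p) {..<n}" by (auto intro: inj_onI)
  have norm: "(real n powr (- 1/2))\<^sup>2 * real n = 1"
    using npos by (simp add: powr_minus powr_half_sqrt field_simps)
  define A where "A i j = real n powr (- 1/2) * rademacher_sign (N + n) i j" for i j
  have A: "A (N + 1 + p) (\<beta> q) * A (N + 1 + p') (\<beta> q') = (real n powr (- 1/2))\<^sup>2 * (walsh m p q * walsh m p' q')"
    if "p < n" "p' < n" for p p' q q'
    by (simp only: A_def sgn that power2_eq_square mult_ac)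
  have "orthogonal_matrix_on {N<..N + n} J A"
    unfolding orthogonal_matrix_on_def
  proof (intro conjI ballI)
    show "card {N<..N + n} = card J" using inj by (simp add: J_def card_image)
  next
    fix j j' assume "j \<in> J" "j' \<in> J"
    then obtain q q' where q: "q < n" "q' < n" "j = \<beta> q" "j' = \<beta> q'" by (auto simp: J_def)
    have "(\<Sum>i\<in>{N<..N + n}. A i j * A i j') = (\<Sum>p<n. A (N + 1 + p) j * A (N + 1 + p) j')"
      unfolding rows by (rule sum.reindex[OF inj_rows, unfolded comp_def])
    also have "\<dots> = (\<Sum>p<n. (real n powr (- 1/2))\<^sup>2 * (walsh m p q * walsh m p q'))"
      by (intro sum.cong refl) (simp only: q A lessThan_iff)
    also have "\<dots> = (real n powr (- 1/2))\<^sup>2 * (if q = q' then real n else 0)"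
      using walsh_orthogonal[of q m q'] q by (simp add: sum_distrib_left[symmetric] n_def)
    also have "\<dots> = (if j = j' then 1 else 0)"
      using inj_onD[OF inj, of q q'] q norm by auto
    finally show "(\<Sum>i\<in>{N<..N + n}. A i j * A i j') = (if j = j' then 1 else 0)" .
  next
    fix i i' assume "i \<in> {N<..N + n}" "i' \<in> {N<..N + n}"
    then obtain p p' where p: "p < n" "p' < n" "i = N + 1 + p" "i' = N + 1 + p'"
      unfolding rows by auto
    have "(\<Sum>j\<in>J. A i j * A i' j) = (\<Sum>q<n. A i (\<beta> q) * A i' (\<beta> q))"
      unfolding J_def by (rule sum.reindex[OF inj, unfolded comp_def])
    \<comment> \<open>Symmetry of the Walsh matrix reduces the orthogonality of rows to that of
      columns.\<close>
    also have "\<dots> = (\<Sum>q<n. (real n powr (- 1/2))\<^sup>2 * (walsh m q p * walsh m q p'))"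
      by (intro sum.cong refl) (simp only: p A walsh_commute[of m p] walsh_commute[of m p'])
    also have "\<dots> = (real n powr (- 1/2))\<^sup>2 * (if p = p' then real n else 0)"
      using walsh_orthogonal[of p m p'] p by (simp add: sum_distrib_left[symmetric] n_def)
    also have "\<dots> = (if i = i' then 1 else 0)"
      using p norm by auto
    finally show "(\<Sum>j\<in>J. A i j * A i' j) = (if i = i' then 1 else 0)" .
  qed (auto simp: J_def)
  have \<beta>_bounds: "2 ^ n * (2 ^ N - 1) \<le> real (\<beta> q) - 1" "real (\<beta> q) \<le> 2 ^ n * (2 ^ N - 1) + 2 ^ n / 2" for q
  proof -
    have "real (\<beta> q) = 2 ^ n * (2 ^ N - 1) + real (c q) + 1"
      by (simp add: \<beta>_def of_nat_diff)
    moreover have "real (c q) + 1 \<le> 2 ^ (n - 1)"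
      using c_half[of q] by (metis Suc_leI of_nat_Suc of_nat_le_iff of_nat_numeral of_nat_power add.commute)
    moreover have "(2::real) ^ n = 2 * 2 ^ (n - 1)" using npos by (simp flip: power_Suc)
    ultimately show "2 ^ n * (2 ^ N - 1) \<le> real (\<beta> q) - 1" "real (\<beta> q) \<le> 2 ^ n * (2 ^ N - 1) + 2 ^ n / 2"
      by auto
  qed
  show ?thesis
  proof
    show "J \<subseteq> {1..2 ^ (N + n)}"
    proof
      fix j assume "j \<in> J"
      then obtain q where j: "j = \<beta> q" by (auto simp: J_def)
      have "real j \<le> 2 ^ n * (2 ^ N - 1) + 2 ^ n / 2"
        using \<beta>_bounds(2)[of q] j by simp
      also have "\<dots> \<le> 2 ^ (N + n)" by (simp add: power_add algebra_simps)
      finally have "real j \<le> 2 ^ (N + n)" .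
      then have "j \<le> 2 ^ (N + n)"
        by (metis of_nat_le_iff of_nat_numeral of_nat_power)
      then show "j \<in> {1..2 ^ (N + n)}" by (simp add: j \<beta>_def)
    qed
    show "card J = n" using inj by (simp add: J_def card_image)
    show "dyadic (N + n) j \<subseteq> {1 - 1 / 2 ^ N .. 1 - 1 / 2 ^ N / 2}" if jJ: "j \<in> J" for j
    proof -
      obtain q where j: "j = \<beta> q" using jJ by (auto simp: J_def)
      have "1 - 1 / 2 ^ N = (2 ^ n * (2 ^ N - 1)) / (2 ^ (N + n) :: real)"
        by (simp add: power_add field_simps)
      also have "\<dots> \<le> (real j - 1) / 2 ^ (N + n)"
        using \<beta>_bounds(1)[of q] j by (intro divide_right_mono) auto
      finally have 1: "1 - 1 / 2 ^ N \<le> (real j - 1) / 2 ^ (N + n)" .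
      have "real j / 2 ^ (N + n) \<le> (2 ^ n * (2 ^ N - 1) + 2 ^ n / 2) / 2 ^ (N + n)"
        using \<beta>_bounds(2)[of q] j by (intro divide_right_mono) auto
      also have "\<dots> = 1 - 1 / 2 ^ N / 2" by (simp add: power_add field_simps)
      finally show ?thesis using 1 by (auto simp: dyadic_def)
    qed
    show "orthogonal_matrix_on {N<..N + n} J (\<lambda>i j. real n powr (- 1/2) * rademacher_sign (N + n) i j)"
      using \<open>orthogonal_matrix_on {N<..N + n} J A\<close> by (simp add: A_def[abs_def])
  qed
qed

subsection \<open>Step functions\<close>

text \<open>Serves both for the function \<open>f\<close> of the theorem, with the sets
  \<open>B k\<close>, and for its equimeasurable copy with the sets \<open>D k\<close>.\<close>

definition step_sum :: "(nat \<Rightarrow> real) \<Rightarrow> (nat \<Rightarrow> real set) \<Rightarrow> real \<Rightarrow> real" where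
  "step_sum \<beta> B t = (\<Sum>k. \<beta> k * indicator (B k) t)"

lemma step_sum_on:
  assumes "disjoint_family B" "t \<in> B k"
  shows "step_sum \<beta> B t = \<beta> k"
proof -
  have "t \<notin> B l" if "l \<noteq> k" for l
    using assms that by (auto simp: disjoint_family_on_def)
  then have "(\<Sum>l. \<beta> l * indicator (B l) t) = (\<Sum>l\<in>{k}. \<beta> l * indicator (B l) t)"
    by (intro suminf_finite) auto
  then show ?thesis using assms(2) by (simp add: step_sum_def)
qed

lemma step_sum_outside: "t \<notin> (\<Union>k. B k) \<Longrightarrow> step_sum \<beta> B t = 0"
  by (simp add: step_sum_def indicator_def)

lemma borel_measurable_step_sum:
  assumes "\<And>k. B k \<in> sets borel"
  shows "step_sum \<beta> B \<in> borel_measurable m01"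
proof -
  have [measurable]: "B k \<in> sets borel" for k by fact
  have "step_sum \<beta> B \<in> borel_measurable borel"
    unfolding step_sum_def by measurable
  then show ?thesis
    by (intro measurable_restrict_space1 measurable_completion) simp
qed

lemma sets_m01_borel: "B \<in> sets borel \<Longrightarrow> B \<subseteq> {0..1} \<Longrightarrow> B \<in> sets m01"
  by (auto simp: sets_restrict_space_iff)

text \<open>Since at most one set contains a given point, the modulus of the product is a sum of
  nonnegative terms; integrating termwise bounds its integral by the convergent majorant.\<close>

lemma integrable_step_sum_mult:
  assumes B: "\<And>k. B k \<in> sets borel" "disjoint_family B" "\<And>k. B k \<subseteq> {0..1}"
    and \<beta>: "\<And>k. \<beta> k \<ge> 0" and x: "integrable m01 x"
    and M: "\<And>k. \<beta> k * (\<integral>t. indicator (B k) t * \<bar>x t\<bar> \<partial>m01) \<le> M k" "summable M"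
  shows "integrable m01 (\<lambda>t. step_sum \<beta> B t * x t)"
proof (rule integrableI_bounded)
  have [measurable]: "B k \<in> sets m01" for k by (rule sets_m01_borel[OF B(1) B(3)])
  have [measurable]: "step_sum \<beta> B \<in> borel_measurable m01" by (rule borel_measurable_step_sum[OF B(1)])
  have [measurable]: "x \<in> borel_measurable m01" using x by simp
  show "(\<lambda>t. step_sum \<beta> B t * x t) \<in> borel_measurable m01" by measurable
  have int: "integrable m01 (\<lambda>t. indicator (B k) t * \<bar>x t\<bar>)" for k
    using integrable_real_mult_indicator[of "B k" m01 "\<lambda>t. \<bar>x t\<bar>"] x by (simp add: mult.commute)
  have M0: "M k \<ge> 0" for k
    by (rule order_trans[OF _ M(1)[of k]]) (simp add: \<beta>)
  have "(\<integral>\<^sup>+t. ennreal (norm (step_sum \<beta> B t * x t)) \<partial>m01) \<le>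
      (\<integral>\<^sup>+t. (\<Sum>k. ennreal (\<beta> k * (indicator (B k) t * \<bar>x t\<bar>))) \<partial>m01)"
  proof (rule nn_integral_mono)
    fix t
    show "ennreal (norm (step_sum \<beta> B t * x t)) \<le> (\<Sum>k. ennreal (\<beta> k * (indicator (B k) t * \<bar>x t\<bar>)))"
    proof (cases "t \<in> (\<Union>k. B k)")
      case True
      then obtain k where k: "t \<in> B k" by auto
      then have "ennreal (norm (step_sum \<beta> B t * x t)) = ennreal (\<beta> k * (indicator (B k) t * \<bar>x t\<bar>))"
        using step_sum_on[OF B(2) k] \<beta>[of k] by (simp add: abs_mult)
      also have "\<dots> = (\<Sum>k\<in>{k}. ennreal (\<beta> k * (indicator (B k) t * \<bar>x t\<bar>)))" by simp
      also have "\<dots> \<le> (\<Sum>k. ennreal (\<beta> k * (indicator (B k) t * \<bar>x t\<bar>)))"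
        by (rule sum_le_suminf) auto
      finally show ?thesis .
    qed (simp add: step_sum_outside)
  qed
  also have "\<dots> = (\<Sum>k. \<integral>\<^sup>+t. ennreal (\<beta> k * (indicator (B k) t * \<bar>x t\<bar>)) \<partial>m01)"
    by (rule nn_integral_suminf) measurable
  also have "\<dots> \<le> (\<Sum>k. ennreal (M k))"
  proof (rule suminf_le)
    fix k
    have "(\<integral>\<^sup>+t. ennreal (\<beta> k * (indicator (B k) t * \<bar>x t\<bar>)) \<partial>m01) =
        ennreal (\<integral>t. \<beta> k * (indicator (B k) t * \<bar>x t\<bar>) \<partial>m01)"
      using int \<beta> by (intro nn_integral_eq_integral) auto
    also have "\<dots> \<le> ennreal (M k)"
      using M(1)[of k] by (intro ennreal_leI) simp
    finally show "(\<integral>\<^sup>+t. ennreal (\<beta> k * (indicator (B k) t * \<bar>x t\<bar>)) \<partial>m01) \<le> ennreal (M k)" .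
  qed auto
  also have "\<dots> = ennreal (\<Sum>k. M k)"
    using M0 M(2) by (intro suminf_ennreal2) auto
  also have "\<dots> < \<infinity>" by simp
  finally show "(\<integral>\<^sup>+t. ennreal (norm (step_sum \<beta> B t * x t)) \<partial>m01) < \<infinity>" .
qed

text \<open>The level set above \<open>\<tau>\<close> is the disjoint union of the sets whose
  coefficient exceeds \<open>\<tau>\<close>, so the distribution function depends only on the
  coefficients and the measures.\<close>

lemma equimeasurable_step_sum:
  assumes B: "\<And>k. B k \<in> sets borel" "disjoint_family B" "\<And>k. B k \<subseteq> {0..1}"
    and D: "\<And>k. D k \<in> sets borel" "disjoint_family D" "\<And>k. D k \<subseteq> {0..1}"
    and \<beta>: "\<And>k. \<beta> k \<ge> 0" and eq: "\<And>k. measure m01 (B k) = measure m01 (D k)"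
  shows "equimeasurable (step_sum \<beta> B) (step_sum \<beta> D)"
proof -
  interpret finite_measure m01 by (rule finite_measure_m01)
  have level: "(\<lambda>k. if \<tau> < \<beta> k then measure m01 (C k) else 0) sums
      measure m01 {t \<in> {0..1}. \<bar>step_sum \<beta> C t\<bar> > \<tau>}"
    if C: "\<And>k. C k \<in> sets borel" "disjoint_family C" "\<And>k. C k \<subseteq> {0..1}" and "\<tau> > 0" for C \<tau>
  proof -
    let ?A = "\<lambda>k. if \<tau> < \<beta> k then C k else {}"
    have "{t \<in> {0..1}. \<bar>step_sum \<beta> C t\<bar> > \<tau>} = (\<Union>k. ?A k)"
    proof (intro equalityI subsetI)
      fix t assume t: "t \<in> {t \<in> {0..1}. \<bar>step_sum \<beta> C t\<bar> > \<tau>}"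
      then have "t \<in> (\<Union>k. C k)" using step_sum_outside[of t C \<beta>] \<open>\<tau> > 0\<close> by fastforce
      then obtain k where k: "t \<in> C k" by auto
      then have "\<tau> < \<beta> k" using t step_sum_on[OF C(2) k, of \<beta>] \<beta>[of k] by auto
      with k show "t \<in> (\<Union>k. ?A k)" by auto
    next
      fix t assume "t \<in> (\<Union>k. ?A k)"
      then obtain k where k: "t \<in> C k" "\<tau> < \<beta> k" by (auto split: if_splits)
      then show "t \<in> {t \<in> {0..1}. \<bar>step_sum \<beta> C t\<bar> > \<tau>}"
        using step_sum_on[OF C(2) k(1), of \<beta>] C(3)[of k] by auto
    qed
    moreover have "(\<lambda>k. measure m01 (?A k)) sums measure m01 (\<Union>k. ?A k)"
    proof (rule measure_UNION)
      show "range ?A \<subseteq> sets m01" using C by (auto intro: sets_m01_borel)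
      show "disjoint_family ?A" using C(2) by (auto simp: disjoint_family_on_def)
    qed simp
    moreover have "(\<lambda>k. measure m01 (?A k)) = (\<lambda>k. if \<tau> < \<beta> k then measure m01 (C k) else 0)"
      by auto
    ultimately show ?thesis by simp
  qed
  show ?thesis
    unfolding equimeasurable_def
  proof (intro conjI allI impI borel_measurable_step_sum B(1) D(1))
    fix \<tau> :: real assume "\<tau> > 0"
    show "measure m01 {t \<in> {0..1}. \<bar>step_sum \<beta> B t\<bar> > \<tau>} = measure m01 {t \<in> {0..1}. \<bar>step_sum \<beta> D t\<bar> > \<tau>}"
      using level[OF B \<open>\<tau> > 0\<close>] level[OF D \<open>\<tau> > 0\<close>] unfolding eq by (rule sums_unique2)
  qed
qed

text \<open>For a level below \<open>c\<close> the level set contains \<open>A\<close> and has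
  measure more than \<open>s\<close>, so all levels in the infimum are at least
  \<open>c\<close>.\<close>

lemma decr_rearr_ge:
  assumes f: "f \<in> borel_measurable m01" and A: "A \<in> sets m01" "\<And>t. t \<in> A \<Longrightarrow> c \<le> \<bar>f t\<bar>"
    and s: "0 < s" "s < measure m01 A"
  shows "c \<le> decr_rearr f s"
  unfolding decr_rearr_def
proof (rule cInf_greatest)
  interpret finite_measure m01 by (rule finite_measure_m01)
  note [measurable] = f
  have level: "{t \<in> {0..1}. \<bar>f t\<bar> > \<tau>} \<in> sets m01" for \<tau>
  proof -
    have "{t \<in> space m01. \<bar>f t\<bar> > \<tau>} \<in> sets m01" by measurable
    then show ?thesis by simp
  qed
  \<comment> \<open>Excludes an infimum over the empty set: \<open>f\<close> is finite everywhere,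
    so the measures of its level sets tend to 0 and some level \<open>n\<close> is
    admissible.\<close>
  have "(\<lambda>n. measure m01 {t \<in> {0..1}. \<bar>f t\<bar> > real n}) \<longlonglongrightarrow>
      measure m01 (\<Inter>n. {t \<in> {0..1}. \<bar>f t\<bar> > real n})"
    using level by (intro finite_Lim_measure_decseq) (auto simp: decseq_def)
  moreover have "(\<Inter>n. {t \<in> {0..1}. \<bar>f t\<bar> > real n}) = {}"
  proof -
    have "\<exists>n. \<not> real n < \<bar>f t\<bar>" for t using real_arch_simple[of "\<bar>f t\<bar>"] by (auto simp: not_less)
    then show ?thesis by blast
  qed
  ultimately have "(\<lambda>n. measure m01 {t \<in> {0..1}. \<bar>f t\<bar> > real n}) \<longlonglongrightarrow> 0" by simp
  then have "\<forall>\<^sub>F n in sequentially. measure m01 {t \<in> {0..1}. \<bar>f t\<bar> > real n} < s"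
    using s(1) by (rule order_tendstoD(2))
  then obtain n where "measure m01 {t \<in> {0..1}. \<bar>f t\<bar> > real n} < s"
    by (auto simp: eventually_sequentially)
  then show "{\<tau>. 0 \<le> \<tau> \<and> measure m01 {t \<in> {0..1}. \<bar>f t\<bar> > \<tau>} \<le> s} \<noteq> {}"
    by (auto intro!: exI[of _ "real n"])
  fix \<tau> assume \<tau>: "\<tau> \<in> {\<tau>. 0 \<le> \<tau> \<and> measure m01 {t \<in> {0..1}. \<bar>f t\<bar> > \<tau>} \<le> s}"
  show "c \<le> \<tau>"
  proof (rule ccontr)
    assume "\<not> c \<le> \<tau>"
    then have "A \<subseteq> {t \<in> {0..1}. \<bar>f t\<bar> > \<tau>}"
      using A sets.sets_into_space[OF A(1)] by fastforce
    then have "measure m01 A \<le> measure m01 {t \<in> {0..1}. \<bar>f t\<bar> > \<tau>}"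
      by (rule finite_measure_mono) (rule level)
    then show False using \<tau> s by auto
  qed
qed

text \<open>Only the interval from 0 to \<open>b\<close> is kept: there the rearrangement is at
  least \<open>c\<close>, and the decreasing logarithmic factor is at least its value at
  \<open>b\<close>.\<close>

lemma nn_integral_decr_rearr_ge:
  fixes b :: real
  assumes f: "f \<in> borel_measurable m01" and A: "A \<in> sets m01" "\<And>t. t \<in> A \<Longrightarrow> c \<le> \<bar>f t\<bar>"
    and b: "measure m01 A = b" "0 < b" "b \<le> 1" and "0 \<le> c"
  shows "ennreal (c * (ln (exp 1 / b)) powr (1/2) * b) \<le>
    (\<integral>\<^sup>+ t. ennreal (decr_rearr f t * (ln (exp 1 / t)) powr (1/2)) \<partial>m01)"
proof -
  define L where "L = (ln (exp 1 / b)) powr (1/2)"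
  have "emeasure m01 {0<..<b} = ennreal b"
    using b by (subst emeasure_restrict_space) auto
  then have "ennreal (c * L * b) = (\<integral>\<^sup>+ t. ennreal (c * L) * indicator {0<..<b} t \<partial>m01)"
    using b \<open>0 \<le> c\<close> by (subst nn_integral_cmult_indicator) (auto simp: ennreal_mult L_def sets_restrict_space_iff)
  also have "\<dots> \<le> (\<integral>\<^sup>+ t. ennreal (decr_rearr f t * (ln (exp 1 / t)) powr (1/2)) \<partial>m01)"
  proof (rule nn_integral_mono)
    fix t
    show "ennreal (c * L) * indicator {0<..<b} t \<le> ennreal (decr_rearr f t * (ln (exp 1 / t)) powr (1/2))"
    proof (cases "t \<in> {0<..<b}")
      case True
      have "exp 1 / b \<le> exp 1 / t" using True by (intro divide_left_mono) auto
      moreover have "exp 1 / b \<ge> 1" using b exp_ge_add_one_self[of "1::real"] by (simp add: field_simps)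
      ultimately have "L \<le> (ln (exp 1 / t)) powr (1/2)"
        unfolding L_def using True b by (intro powr_mono2) (auto intro!: ln_mono ln_ge_zero)
      moreover have "c \<le> decr_rearr f t"
        using True b by (intro decr_rearr_ge[OF f A]) auto
      ultimately have "c * L \<le> decr_rearr f t * (ln (exp 1 / t)) powr (1/2)"
        using \<open>0 \<le> c\<close> by (intro mult_mono) (auto simp: L_def)
      then show ?thesis using True by (simp add: ennreal_leI)
    qed simp
  qed
  finally show ?thesis by (simp add: L_def)
qed

section \<open>Measures of dyadic sets and second moments on an orthogonal block\<close>

lemma negligible_dyadic_Int:
  assumes "j \<noteq> j'" shows "negligible (dyadic n j \<inter> dyadic n j')"
proof -
  have "dyadic n j \<inter> dyadic n j' \<subseteq> {real j / 2 ^ n, real j' / 2 ^ n}"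
  proof
    fix t assume "t \<in> dyadic n j \<inter> dyadic n j'"
    then have "real j - 1 \<le> t * 2 ^ n" "t * 2 ^ n \<le> real j" "real j' - 1 \<le> t * 2 ^ n" "t * 2 ^ n \<le> real j'"
      by (auto simp: dyadic_def field_simps)
    moreover have "real j + 1 \<le> real j' \<or> real j' + 1 \<le> real j" using assms by linarith
    ultimately have "t * 2 ^ n = real j \<or> t * 2 ^ n = real j'" by linarith
    then show "t \<in> {real j / 2 ^ n, real j' / 2 ^ n}" by (auto simp: field_simps)
  qed
  then show ?thesis by (rule negligible_subset[rotated]) simp
qed

lemma measure_dyadic: "measure lebesgue (dyadic n j) = 1 / 2 ^ n"
  by (simp add: dyadic_def divide_right_mono field_simps)

lemma lmeasurable_dyadic: "dyadic n j \<in> lmeasurable"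
  by (simp add: dyadic_def)

lemma measure_m01: "B \<subseteq> {0..1} \<Longrightarrow> B \<in> sets borel \<Longrightarrow> measure m01 B = measure lebesgue B"
  by (rule measure_restrict_space) auto

lemma measure_UN_dyadic:
  assumes "finite J" shows "measure lebesgue (\<Union>j\<in>J. dyadic n j) = real (card J) / 2 ^ n"
proof -
  have "measure lebesgue (\<Union>j\<in>J. dyadic n j) = (\<Sum>j\<in>J. measure lebesgue (dyadic n j))"
    using assms by (intro measure_negligible_finite_Union_image) (auto simp: pairwise_def negligible_dyadic_Int lmeasurable_dyadic)
  then show ?thesis by (simp add: measure_dyadic)
qed

lemma rademacher_sum_L1_limit:
  assumes "rademacher_sum_L1 a x"
  shows "integrable m01 x" "(\<lambda>n. \<integral>t. \<bar>x t - rad_sum a n t\<bar> \<partial>m01) \<longlonglongrightarrow> 0"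
  using assms by (auto simp: rademacher_sum_L1_def rad_sum_def)

text \<open>An orthogonal block of columns \<open>J\<close> makes the squares of the block sums average out over \<open>J\<close>;
  the earlier Rademacher functions are estimated by Cauchy--Schwarz only.\<close>

lemma integral_rad_sum_orthogonal_block:
  fixes N n m :: nat
  assumes J: "J \<subseteq> {1..2 ^ (N + n)}" "card J = n" "n > 0"
    and orth: "orthogonal_matrix_on {N<..N + n} J (\<lambda>i j. real n powr (- 1/2) * rademacher_sign (N + n) i j)"
    and K: "(\<Sum>i=1..m. (a i)\<^sup>2) \<le> K" and m: "N + n \<le> m"
    and sub: "(\<Union>j\<in>J. dyadic (N + n) j) \<subseteq> {0..1}"
  shows "(\<integral>t. indicator (\<Union>j\<in>J. dyadic (N + n) j) t * \<bar>rad_sum a m t\<bar> \<partial>m01) \<le>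
    real n / 2 ^ (N + n) * ((1 + K * (2 * real N + 3)) / 2)"
proof -
  define B where "B = (\<Union>j\<in>J. dyadic (N + n) j)"
  define r where "r i j = rademacher_sign (N + n) i j" for i j
  define T where "T = (\<Sum>i=Suc (N + n)..m. (a i)\<^sup>2)"
  define p q where "p j = (\<Sum>i=1..N. a i * r i j)" and "q j = (\<Sum>i\<in>{N<..N+n}. a i * r i j)" for j
  have finJ: "finite J" using J(1) by (rule finite_subset) simp
  have B: "B \<in> sets borel" "B \<subseteq> {0..1}"
    using finJ sub by (auto simp: B_def dyadic_def)
  have le_K: "(\<Sum>i\<in>I. (a i)\<^sup>2) \<le> K" if "I \<subseteq> {1..m}" for I
    using sum_mono2[OF _ that, of "\<lambda>i. (a i)\<^sup>2"] K by auto
  \<comment> \<open>The mean square on one interval is the square of the part fixed there,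
    \<open>p j + q j\<close>, plus the tail \<open>T\<close> of the later coefficients.\<close>
  have int_j: "((\<lambda>t. (rad_sum a m t)\<^sup>2) has_integral (((p j + q j)\<^sup>2 + T) / 2 ^ (N + n))) (dyadic (N + n) j)"
    if "j \<in> J" for j
  proof -
    have "{1..N+n} = {1..N} \<union> {N<..N+n}" "{1..N} \<inter> {N<..N+n} = {}" by auto
    then have "(\<Sum>i=1..N + n. a i * r i j) = p j + q j" by (simp add: p_def q_def sum.union_disjoint)
    then show ?thesis
      using has_integral_rad_sum_dyadic[of j "N + n" m "\<lambda>u. u\<^sup>2" a] J(1) that m
      by (auto simp: sign_avg_square T_def r_def)
  qed
  have I: "((\<lambda>t. (rad_sum a m t)\<^sup>2) has_integral (\<Sum>j\<in>J. ((p j + q j)\<^sup>2 + T) / 2 ^ (N + n))) B"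
    unfolding B_def using finJ int_j
    by (intro has_integral_UN) (auto simp: pairwise_def negligible_dyadic_Int)
  have p: "(p j)\<^sup>2 \<le> real N * K" if "j \<in> J" for j
  proof -
    have "(p j)\<^sup>2 \<le> (\<Sum>i=1..N. (r i j)\<^sup>2) * (\<Sum>i=1..N. (a i)\<^sup>2)"
      unfolding p_def using Cauchy_Schwarz_ineq_sum[of "\<lambda>i. r i j" a "{1..N}"] by (simp add: mult.commute)
    also have "(\<Sum>i=1..N. (r i j)\<^sup>2) = (\<Sum>i=1..N. 1)"
    proof (rule sum.cong)
      fix i assume "i \<in> {1..N}"
      then have "\<bar>r i j\<bar> = 1" unfolding r_def using J(1) that by (intro abs_rademacher_sign) auto
      then show "(r i j)\<^sup>2 = 1" by (metis power2_abs one_power2)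
    qed simp
    also have "(\<Sum>i=1..N. 1) * (\<Sum>i=1..N. (a i)\<^sup>2) \<le> real N * K"
      using le_K[of "{1..N}"] m by (simp add: mult_left_mono)
    finally show ?thesis .
  qed
  \<comment> \<open>The normalised matrix preserves the sum of squares; undoing the normalisation
    costs the factor \<open>n\<close>.\<close>
  have q: "(\<Sum>j\<in>J. (q j)\<^sup>2) \<le> real n * K"
  proof -
    have "real n powr (- 1/2) * q j = (\<Sum>i\<in>{N<..N+n}. a i * (real n powr (- 1/2) * r i j))" for j
      by (simp add: q_def sum_distrib_left mult_ac)
    then have "(\<Sum>j\<in>J. (real n powr (- 1/2) * q j)\<^sup>2) = (\<Sum>i\<in>{N<..N+n}. (a i)\<^sup>2)"
      using sum_orthogonal_square[OF orth, of a] by (simp add: r_def)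
    also have "\<dots> \<le> K" using m by (intro le_K) auto
    finally have "(real n powr (- 1/2))\<^sup>2 * (\<Sum>j\<in>J. (q j)\<^sup>2) \<le> K"
      by (simp add: power_mult_distrib sum_distrib_left)
    moreover have "(real n powr (- 1/2))\<^sup>2 = 1 / real n"
      using J(3) by (simp add: powr_minus powr_half_sqrt field_simps)
    ultimately have "1 / real n * (\<Sum>j\<in>J. (q j)\<^sup>2) \<le> K" by (simp only:)
    then show ?thesis using J(3) by (simp add: field_simps)
  qed
  \<comment> \<open>In units of \<open>K\<close> and averaged over \<open>J\<close>, the earlier
    functions contribute \<open>2 * N\<close>, the block contributes 2 and the tail 1, whence
    \<open>2 * N + 3\<close>.\<close>
  have "(\<Sum>j\<in>J. (p j + q j)\<^sup>2 + T) \<le> (\<Sum>j\<in>J. 2 * (real N * K) + 2 * (q j)\<^sup>2 + K)"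
  proof (rule sum_mono)
    fix j assume j: "j \<in> J"
    have "(p j + q j)\<^sup>2 \<le> 2 * (p j)\<^sup>2 + 2 * (q j)\<^sup>2"
      using zero_le_power2[of "p j - q j"] by (simp add: power2_sum power2_diff)
    moreover have "T \<le> K" unfolding T_def by (intro le_K) auto
    ultimately show "(p j + q j)\<^sup>2 + T \<le> 2 * (real N * K) + 2 * (q j)\<^sup>2 + K"
      using p[OF j] by linarith
  qed
  also have "\<dots> \<le> real n * (K * (2 * real N + 3))"
    using q J(2) by (simp add: sum.distrib sum_distrib_left[symmetric] algebra_simps)
  finally have sq: "(\<Sum>j\<in>J. ((p j + q j)\<^sup>2 + T) / 2 ^ (N + n)) \<le> real n / 2 ^ (N + n) * (K * (2 * real N + 3))"
    by (simp add: sum_divide_distrib[symmetric] divide_right_mono)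
  have cont: "continuous_on UNIV (\<lambda>u :: real. u\<^sup>2)" by (intro continuous_intros)
  have cont_abs: "continuous_on UNIV (\<lambda>u :: real. \<bar>u\<bar>)" by (intro continuous_intros)
  have int2: "integrable m01 (\<lambda>t. indicator B t * (rad_sum a m t)\<^sup>2)"
      "(\<integral>t. indicator B t * (rad_sum a m t)\<^sup>2 \<partial>m01) = (\<Sum>j\<in>J. ((p j + q j)\<^sup>2 + T) / 2 ^ (N + n))"
    by (rule rad_sum_integral[OF cont B I])+
  have Bm: "B \<in> sets m01" by (rule sets_m01_borel[OF B])
  have int1: "integrable m01 (\<lambda>t. indicator B t :: real)"
    using Bm finite_measure.emeasure_finite[OF finite_measure_m01, of B] by (auto simp: less_top)
  have meas: "(\<integral>t. indicator B t \<partial>m01) = real n / 2 ^ (N + n)"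
    using measure_UN_dyadic[OF finJ, of "N + n"] measure_m01[OF B(2,1)] J(2) Int_absorb2[OF B(2)]
    by (simp add: B_def[symmetric])
  have intabs: "integrable m01 (\<lambda>t. indicator B t * \<bar>rad_sum a m t\<bar>)"
    using integrable_real_mult_indicator[OF Bm rad_sum_integral_m01(1)[OF cont_abs, of a m]]
    by (simp add: mult.commute)
  \<comment> \<open>The pointwise bound \<open>\<bar>u\<bar> \<le> (1 + u\<^sup>2) / 2\<close> leads
    from second to first moments.\<close>
  have "(\<integral>t. indicator B t * \<bar>rad_sum a m t\<bar> \<partial>m01) \<le>
      (\<integral>t. (indicator B t + indicator B t * (rad_sum a m t)\<^sup>2) / 2 \<partial>m01)"
  proof (rule integral_mono)
    fix t
    show "indicator B t * \<bar>rad_sum a m t\<bar> \<le> (indicator B t + indicator B t * (rad_sum a m t)\<^sup>2) / 2"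
      using abs_le_square[of 1 "rad_sum a m t"] by (auto simp: indicator_def)
  qed (use int1 int2 intabs in auto)
  also have "\<dots> = ((\<integral>t. indicator B t \<partial>m01) + (\<integral>t. indicator B t * (rad_sum a m t)\<^sup>2 \<partial>m01)) / 2"
    using int1 int2(1) by (simp del: Bochner_Integration.integral_indicator)
  also have "\<dots> \<le> (real n / 2 ^ (N + n) + real n / 2 ^ (N + n) * (K * (2 * real N + 3))) / 2"
    unfolding meas int2(2) by (intro divide_right_mono add_left_mono sq) simp
  also have "\<dots> = real n / 2 ^ (N + n) * ((1 + K * (2 * real N + 3)) / 2)"
    by (simp only: distrib_left times_divide_eq_right mult_1_right)
  finally show ?thesis by (simp add: B_def)
qed

subsection \<open>Estimates on a single block\<close>

text \<open>Carries estimates on a block from partial sums to the L1 limit: taking moduli and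
  restricting to \<open>B\<close> do not increase L1 distances.\<close>

lemma tendsto_integral_abs_rad_sum:
  assumes x: "rademacher_sum_L1 a x" and B: "B \<in> sets m01"
  shows "(\<lambda>n. \<integral>t. indicator B t * \<bar>rad_sum a n t\<bar> \<partial>m01) \<longlonglongrightarrow> (\<integral>t. indicator B t * \<bar>x t\<bar> \<partial>m01)"
proof -
  note lim = rademacher_sum_L1_limit[OF x]
  have cont: "continuous_on UNIV (\<lambda>u :: real. u)" by (intro continuous_intros)
  have S: "integrable m01 (rad_sum a n)" for n by (rule rad_sum_integral_m01(1)[OF cont])
  have ind: "integrable m01 (\<lambda>t. indicator B t * \<bar>g t\<bar>)" if "integrable m01 g" for g :: "real \<Rightarrow> real"
    using integrable_real_mult_indicator[OF B, of "\<lambda>t. \<bar>g t\<bar>"] that by (simp add: mult.commute)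
  have "norm ((\<integral>t. indicator B t * \<bar>rad_sum a n t\<bar> \<partial>m01) - (\<integral>t. indicator B t * \<bar>x t\<bar> \<partial>m01)) \<le>
      (\<integral>t. \<bar>x t - rad_sum a n t\<bar> \<partial>m01)" for n
  proof -
    have "(\<integral>t. indicator B t * \<bar>rad_sum a n t\<bar> \<partial>m01) - (\<integral>t. indicator B t * \<bar>x t\<bar> \<partial>m01) =
        (\<integral>t. indicator B t * \<bar>rad_sum a n t\<bar> - indicator B t * \<bar>x t\<bar> \<partial>m01)"
      by (intro Bochner_Integration.integral_diff[symmetric] ind S lim)
    also have "norm \<dots> \<le> (\<integral>t. norm (indicator B t * \<bar>rad_sum a n t\<bar> - indicator B t * \<bar>x t\<bar>) \<partial>m01)"
      by (rule integral_norm_bound)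
    also have "\<dots> \<le> (\<integral>t. \<bar>x t - rad_sum a n t\<bar> \<partial>m01)"
      by (intro integral_mono integrable_norm integrable_abs Bochner_Integration.integrable_diff ind S lim)
         (auto simp: indicator_def)
    finally show ?thesis .
  qed
  then have "(\<lambda>n. (\<integral>t. indicator B t * \<bar>rad_sum a n t\<bar> \<partial>m01) - (\<integral>t. indicator B t * \<bar>x t\<bar> \<partial>m01)) \<longlonglongrightarrow> 0"
    by (intro Lim_null_comparison[OF _ lim(2)]) simp
  then show ?thesis by (simp add: LIM_zero_iff)
qed

text \<open>This is the leftmost interval of rank \<open>N + p\<close> inside the rightmost one of
  rank \<open>N\<close>: the binary digits of its number, from 0, are \<open>N\<close> ones followed
  by \<open>p\<close> zeros.\<close>

lemma dyadic_after:
  fixes N p :: nat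
  shows "dyadic (N + p) (2 ^ p * (2 ^ N - 1) + 1) = {1 - 1 / 2 ^ N .. 1 - 1 / 2 ^ N + 1 / 2 ^ (N + p)}"
  by (simp add: dyadic_def of_nat_diff power_add field_simps)

text \<open>On \<open>D\<close> the Rademacher functions with indices from \<open>N + 1\<close> to
  \<open>N + p\<close> equal 1 and the later ones have mean zero; the first \<open>N\<close> terms
  are estimated by their moduli.\<close>

lemma integral_rad_sum_dyadic_ge:
  fixes N p m :: nat
  defines "D \<equiv> dyadic (N + p) (2 ^ p * (2 ^ N - 1) + 1)"
  assumes m: "N + p \<le> m" and D01: "D \<subseteq> {0..1}"
  shows "((\<Sum>i\<in>{N<..N + p}. a i) - (\<Sum>i=1..N. \<bar>a i\<bar>)) / 2 ^ (N + p) \<le>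
    (\<integral>t. indicator D t * \<bar>rad_sum a m t\<bar> \<partial>m01)"
proof -
  define j where "j = (2 ^ p * (2 ^ N - 1) + 1 :: nat)"
  define c where "c = (\<Sum>i=1..N + p. a i * rademacher_sign (N + p) i j)"
  have j: "1 \<le> j" by (simp add: j_def)
  have pos: "rademacher_sign (N + p) i j = 1" if "i \<in> {N<..N + p}" for i
  proof -
    define r where "r = i - Suc N"
    have "p = Suc r + (N + p - i)" using that by (auto simp: r_def)
    then have "(2::nat) ^ p = 2 ^ Suc r * 2 ^ (N + p - i)" by (metis power_add)
    then have "j - 1 = 2 ^ (N + p - i) * (2 * (2 ^ r * (2 ^ N - 1)))" by (simp add: j_def mult_ac)
    then have "(j - 1) div 2 ^ (N + p - i) = 2 * (2 ^ r * (2 ^ N - 1))"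
      by (simp only: nonzero_mult_div_cancel_left) simp
    then show ?thesis using that j by (simp add: rademacher_sign_eq)
  qed
  have "{1..N+p} = {1..N} \<union> {N<..N+p}" "{1..N} \<inter> {N<..N+p} = {}" by auto
  then have "c = (\<Sum>i=1..N. a i * rademacher_sign (N + p) i j) + (\<Sum>i\<in>{N<..N+p}. a i)"
    using pos by (simp add: c_def sum.union_disjoint)
  moreover have "\<bar>\<Sum>i=1..N. a i * rademacher_sign (N + p) i j\<bar> \<le> (\<Sum>i=1..N. \<bar>a i\<bar>)"
    using j by (intro order_trans[OF sum_abs] sum_mono) (simp add: abs_mult abs_rademacher_sign)
  ultimately have "(\<Sum>i\<in>{N<..N + p}. a i) - (\<Sum>i=1..N. \<bar>a i\<bar>) \<le> c" by linarith
  then have "((\<Sum>i\<in>{N<..N + p}. a i) - (\<Sum>i=1..N. \<bar>a i\<bar>)) / 2 ^ (N + p) \<le> c / 2 ^ (N + p)"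
    by (intro divide_right_mono) auto
  also have "\<dots> \<le> (\<integral>t. indicator D t * \<bar>rad_sum a m t\<bar> \<partial>m01)"
  proof -
    have cont: "continuous_on UNIV (\<lambda>u :: real. u)" "continuous_on UNIV (\<lambda>u :: real. \<bar>u\<bar>)"
      by (intro continuous_intros)+
    have D: "D \<in> sets borel" by (simp add: D_def dyadic_def)
    have "(rad_sum a m has_integral c / 2 ^ (N + p)) D"
      using has_integral_rad_sum_dyadic[OF j m, of "\<lambda>u. u" a]
      by (simp add: sign_avg_id c_def D_def j_def)
    note I = rad_sum_integral[OF cont(1) D D01 this]
    have "c / 2 ^ (N + p) = (\<integral>t. indicator D t * rad_sum a m t \<partial>m01)" by (rule I(2)[symmetric])
    also have "\<dots> \<le> (\<integral>t. indicator D t * \<bar>rad_sum a m t\<bar> \<partial>m01)"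
    proof (rule integral_mono[OF I(1)])
      show "integrable m01 (\<lambda>t. indicator D t * \<bar>rad_sum a m t\<bar>)"
        using integrable_real_mult_indicator[OF sets_m01_borel[OF D D01] rad_sum_integral_m01(1)[OF cont(2), of a m]]
        by (simp add: mult.commute)
    qed (auto simp: indicator_def)
    finally show ?thesis .
  qed
  finally show ?thesis .
qed

text \<open>For a block of length \<open>2 ^ m\<close>, the single interval with the measure of the
  block fixes all but \<open>m\<close> of its signs, hence at least half of them.\<close>

lemma half_le_diff_log: "real (2 ^ m) / 2 \<le> real (2 ^ m - m)"
proof -
  have "2 * m \<le> 2 ^ m"
  proof (induction m)
    case (Suc m)
    then show ?case by (cases m) auto
  qed simp
  then have "real (2 * m) \<le> real (2 ^ m)" by (rule of_nat_mono)
  moreover have "m \<le> 2 ^ m" by (simp add: less_imp_le)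
  ultimately show ?thesis by (simp add: of_nat_diff)
qed

section \<open>Numerical consequences of the growth condition for one block\<close>

context
  fixes n N :: nat
  assumes n_pos: "1 \<le> n" and growth: "2 ^ N \<le> real n powr (1/8)"
begin

text \<open>The left-hand side is the coefficient of a block times its measure.\<close>

lemma weight_eq: "2 ^ n * real n powr (- 5/4) * (real n / 2 ^ (N + n)) = real n powr (- 1/4) / 2 ^ N"
proof -
  have "real n powr (- 5/4) * real n = real n powr (- 5/4) * real n powr 1"
    using n_pos by simp
  also have "\<dots> = real n powr (- 1/4)" by (subst powr_add[symmetric]) simp
  finally have "real n powr (- 5/4) * real n = real n powr (- 1/4)" .
  then show ?thesis by (simp add: power_add field_simps)
qed

text \<open>By the growth condition the factor \<open>2 ^ N\<close> costs at most 1/8 in the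
  exponent.\<close>

lemma weight_ge: "real n powr (- 3/8) \<le> real n powr (- 1/4) / 2 ^ N"
proof -
  have "real n powr (- 3/8) * 2 ^ N \<le> real n powr (- 3/8) * real n powr (1/8)"
    using growth by (intro mult_left_mono) auto
  also have "\<dots> = real n powr (- 1/4)" by (subst powr_add[symmetric]) simp
  finally show ?thesis by (simp add: field_simps)
qed

lemma N_le: "real N \<le> real n powr (1/8)"
  using of_nat_less_two_power[of N] growth by (metis less_imp_le order_trans)

text \<open>The square of the growth condition gives
  \<open>real n powr (- 1/4) \<le> 1 / 4 ^ N\<close>, and the remaining \<open>1 / 2 ^ N\<close>
  absorbs the linear growth of \<open>2 * real N + 3\<close>.\<close>

lemma upper_estimate:
  assumes "0 \<le> K"
  shows "real n powr (- 1/4) / 2 ^ N * ((1 + K * (2 * real N + 3)) / 2) \<le> 3 * (1 + K) / 4 ^ N"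
proof -
  have "(2 ^ N)\<^sup>2 \<le> (real n powr (1/8))\<^sup>2"
    using growth by (intro power_mono) auto
  also have "\<dots> = real n powr (1/4)" by (simp add: power2_eq_square flip: powr_add)
  also have "(2 ^ N)\<^sup>2 = (4 ^ N :: real)" by (simp add: power2_eq_square flip: power_mult_distrib)
  finally have "4 ^ N \<le> real n powr (1/4)" .
  moreover have "real n powr (- 1/4) * real n powr (1/4) = 1"
    using n_pos by (subst powr_add[symmetric]) simp
  ultimately have 1: "real n powr (- 1/4) \<le> 1 / 4 ^ N"
    using mult_left_mono[of "4 ^ N" "real n powr (1/4)" "real n powr (- 1/4)"] by (simp add: field_simps)
  have "real N \<le> 2 ^ N" "(1::real) \<le> 2 ^ N" using of_nat_less_two_power[of N] by (auto simp: less_imp_le)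
  then have "2 * real N + 3 \<le> 6 * 2 ^ N" by linarith
  then have "K * (2 * real N + 3) \<le> K * (6 * 2 ^ N)" using assms by (rule mult_left_mono)
  then have "1 + K * (2 * real N + 3) \<le> 6 * 2 ^ N + K * (6 * 2 ^ N)"
    using \<open>1 \<le> 2 ^ N\<close> by linarith
  then have "(1 + K * (2 * real N + 3)) / 2 \<le> 3 * (1 + K) * 2 ^ N"
    by (simp add: algebra_simps)
  then have 2: "(1 + K * (2 * real N + 3)) / 2 / 2 ^ N \<le> 3 * (1 + K)" by (simp add: field_simps)
  have "real n powr (- 1/4) / 2 ^ N * ((1 + K * (2 * real N + 3)) / 2) =
      real n powr (- 1/4) * ((1 + K * (2 * real N + 3)) / 2 / 2 ^ N)" by simp
  also have "\<dots> \<le> 1 / 4 ^ N * (3 * (1 + K))"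
    using 1 2 assms by (intro mult_mono) auto
  finally show ?thesis by simp
qed

text \<open>At least \<open>n / 2\<close> terms of size at least \<open>(2 * n) powr (- 3/5)\<close>
  sum to at least \<open>n powr (2/5) / 4\<close>; against the weight \<open>n powr (- 3/8)\<close>
  this leaves the exponent 2/5 - 3/8 = 1/40. The first \<open>N \<le> n powr (1/8)\<close> terms
  cost at most 1 after weighting.\<close>

lemma lower_estimate:
  assumes p: "real n / 2 \<le> real p" "p \<le> n"
  shows "real n powr (1/40) / 4 - 1 \<le>
    real n powr (- 1/4) / 2 ^ N * ((\<Sum>i\<in>{N<..N + p}. real i powr (- 3/5)) - (\<Sum>i=1..N. \<bar>real i powr (- 3/5)\<bar>))"
proof -
  define w where "w = real n powr (- 1/4) / 2 ^ N"
  have "w \<ge> 0" by (simp add: w_def)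
  \<comment> \<open>\<open>N \<le> n\<close> ensures that the indices in the block do not exceed
    \<open>2 * n\<close>.\<close>
  have "real n powr (1/8) \<le> real n powr 1" using n_pos by (intro powr_mono) auto
  then have "real N \<le> real n" using N_le n_pos by simp
  have each: "(2 * real n) powr (- 3/5) \<le> real i powr (- 3/5)" if "i \<in> {N<..N + p}" for i
    using that \<open>real N \<le> real n\<close> p(2) by (intro powr_mono2') auto
  have "(2::real) powr (- 1) \<le> 2 powr (- 3/5)" by (intro powr_mono) auto
  then have two: "(1/2 :: real) \<le> 2 powr (- 3/5)" by (simp add: powr_minus)
  have "real n powr (2/5) / 4 = real n / 2 * (1/2 * real n powr (- 3/5))"
  proof -
    have "real n * real n powr (- 3/5) = real n powr 1 * real n powr (- 3/5)" using n_pos by simp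
    also have "\<dots> = real n powr (2/5)" by (subst powr_add[symmetric]) simp
    finally show ?thesis by simp
  qed
  also have "\<dots> \<le> real p * (2 powr (- 3/5) * real n powr (- 3/5))"
    using p two by (intro mult_mono) auto
  also have "\<dots> = (\<Sum>i\<in>{N<..N + p}. (2 * real n) powr (- 3/5))" by (simp add: powr_mult)
  also have "\<dots> \<le> (\<Sum>i\<in>{N<..N + p}. real i powr (- 3/5))" by (intro sum_mono each)
  finally have big: "real n powr (2/5) / 4 \<le> (\<Sum>i\<in>{N<..N + p}. real i powr (- 3/5))" .
  have "(\<Sum>i=1..N. \<bar>real i powr (- 3/5)\<bar>) \<le> (\<Sum>i=1..N. 1)"
  proof (rule sum_mono)
    fix i assume "i \<in> {1..N}"
    then show "\<bar>real i powr (- 3/5)\<bar> \<le> 1" using powr_mono[of "- 3/5" 0 "real i"] by simp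
  qed
  then have small: "(\<Sum>i=1..N. \<bar>real i powr (- 3/5)\<bar>) \<le> real n powr (1/8)" using N_le by simp
  have "w \<le> real n powr (- 1/4) / 1" unfolding w_def by (rule divide_left_mono) auto
  then have "w * real n powr (1/8) \<le> real n powr (- 1/4) * real n powr (1/8)"
    by (intro mult_right_mono) auto
  also have "\<dots> = real n powr (- 1/8)" by (subst powr_add[symmetric]) simp
  also have "\<dots> \<le> 1" using powr_mono[of "- 1/8" 0 "real n"] n_pos by simp
  finally have s: "w * (\<Sum>i=1..N. \<bar>real i powr (- 3/5)\<bar>) \<le> 1"
    using mult_left_mono[OF small \<open>w \<ge> 0\<close>] by linarith
  have "real n powr (- 3/8) * real n powr (2/5) = real n powr (1/40)" by (subst powr_add[symmetric]) simp
  then have "real n powr (1/40) / 4 = real n powr (- 3/8) * (real n powr (2/5) / 4)"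
    by (simp only: times_divide_eq_right)
  also have "\<dots> \<le> w * (real n powr (2/5) / 4)" using weight_ge by (intro mult_right_mono) (auto simp: w_def)
  also have "\<dots> \<le> w * (\<Sum>i\<in>{N<..N + p}. real i powr (- 3/5))" using big \<open>w \<ge> 0\<close> by (rule mult_left_mono)
  finally show ?thesis using s unfolding w_def[symmetric] right_diff_distrib by linarith
qed

text \<open>Here \<open>1 / b\<close> is a power of 2 with exponent at least \<open>n / 2\<close>,
  so the logarithm is at least \<open>n / 4\<close>; its square root beats the weight by the
  exponent 1/2 - 3/8 = 1/8.\<close>

lemma log_estimate:
  assumes m: "n = 2 ^ m" and b: "b = real n / 2 ^ (N + n)"
  shows "real n powr (1/8) / 2 \<le> 2 ^ n * real n powr (- 5/4) * (ln (exp 1 / b)) powr (1/2) * b"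
proof -
  have "m \<le> n" using m by (simp add: less_imp_le)
  then have "N + n = m + (N + (n - m))" by simp
  then have "(2::real) ^ (N + n) = 2 ^ m * 2 ^ (N + (n - m))" by (metis power_add)
  then have "2 ^ (N + n) = real n * 2 ^ (N + (n - m))" by (simp add: m)
  moreover define M where "M = N + (n - m)"
  ultimately have "exp 1 / b = exp 1 * 2 ^ M" using n_pos by (simp add: b)
  then have "ln (exp 1 / b) = 1 + real M * ln 2"
    by (simp add: ln_mult ln_realpow)
  moreover have "real M * (1/2) \<le> real M * ln 2"
    using ln2_ge_two_thirds by (intro mult_left_mono) auto
  moreover have "real n / 2 \<le> real (n - m)" unfolding m by (rule half_le_diff_log)
  then have "real n / 2 \<le> real M" by (rule order_trans) (simp add: M_def)
  ultimately have "real n / 4 \<le> ln (exp 1 / b)" by linarith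
  then have "(real n / 4) powr (1/2) \<le> (ln (exp 1 / b)) powr (1/2)" by (intro powr_mono2) auto
  then have "real n powr (1/2) / 2 \<le> (ln (exp 1 / b)) powr (1/2)"
    by (simp add: powr_half_sqrt real_sqrt_divide)
  then have "real n powr (- 3/8) * (real n powr (1/2) / 2) \<le> real n powr (- 1/4) / 2 ^ N * (ln (exp 1 / b)) powr (1/2)"
    using weight_ge by (intro mult_mono) auto
  moreover have "real n powr (- 3/8) * real n powr (1/2) = real n powr (1/8)" by (subst powr_add[symmetric]) simp
  ultimately show ?thesis unfolding weight_eq[symmetric] b by (simp only: times_divide_eq_right mult_ac)
qed

end

section \<open>Unboundedness and disjointness criteria, and the construction itself\<close>

lemma powr_of_nat_unbounded:
  fixes n :: "nat \<Rightarrow> nat"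
  assumes "\<And>k. k \<le> n k" "e > 0"
  shows "\<exists>k. C < real (n k) powr e"
proof -
  obtain k where k: "(max C 1) powr (1/e) < real k" using reals_Archimedean2 by blast
  have "max C 1 = ((max C 1) powr (1/e)) powr e" using assms(2) by (simp add: powr_powr)
  also have "\<dots> < real k powr e" using k assms(2) by (intro powr_less_mono2) auto
  also have "\<dots> \<le> real (n k) powr e" using assms by (intro powr_mono2) auto
  finally show ?thesis by auto
qed

text \<open>If the product were integrable, its L1 norm would bound the contribution of every single
  set.\<close>

lemma not_mult_L1I:
  assumes D: "\<And>k. D k \<in> sets borel" "disjoint_family D" "\<And>k. D k \<subseteq> {0..1}"
    and \<beta>: "\<And>k. 0 \<le> \<beta> k" and x: "rademacher_sum_L1 a x"
    and unbounded: "\<And>C. \<exists>k. C < \<beta> k * (\<integral>t. indicator (D k) t * \<bar>x t\<bar> \<partial>m01)"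
  shows "step_sum \<beta> D \<notin> mult_L1"
proof
  assume "step_sum \<beta> D \<in> mult_L1"
  then have int: "integrable m01 (\<lambda>t. step_sum \<beta> D t * x t)" using x by (auto simp: mult_L1_def)
  have "\<beta> k * (\<integral>t. indicator (D k) t * \<bar>x t\<bar> \<partial>m01) \<le> (\<integral>t. \<bar>step_sum \<beta> D t * x t\<bar> \<partial>m01)" for k
  proof -
    have Dm: "D k \<in> sets m01" by (rule sets_m01_borel[OF D(1,3)])
    have "integrable m01 (\<lambda>t. \<bar>x t\<bar>)" using rademacher_sum_L1_limit(1)[OF x] by simp
    from integrable_real_mult_indicator[OF Dm this]
    have "integrable m01 (\<lambda>t. \<beta> k * (indicator (D k) t * \<bar>x t\<bar>))" by (simp add: mult.commute)
    then have "(\<integral>t. \<beta> k * (indicator (D k) t * \<bar>x t\<bar>) \<partial>m01) \<le> (\<integral>t. \<bar>step_sum \<beta> D t * x t\<bar> \<partial>m01)"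
    proof (rule integral_mono)
      fix t
      show "\<beta> k * (indicator (D k) t * \<bar>x t\<bar>) \<le> \<bar>step_sum \<beta> D t * x t\<bar>"
        using step_sum_on[OF D(2), of t k \<beta>] \<beta>[of k] by (cases "t \<in> D k") (auto simp: abs_mult)
    qed (use int in auto)
    then show ?thesis by simp
  qed
  then show False using unbounded[of "\<integral>t. \<bar>step_sum \<beta> D t * x t\<bar> \<partial>m01"] by (meson not_less)
qed

text \<open>If the rank grows by 2 or more, later sets lie to the right of
  \<open>1 - 1 / 2 ^ N k / 4\<close>, inclusive. This is strictly beyond the right end for
  \<open>k\<close>, so even closed intervals cannot touch.\<close>

lemma disjoint_family_gaps:
  fixes N :: "nat \<Rightarrow> nat"
  assumes N: "\<And>k. N k + 2 \<le> N (Suc k)"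
    and A: "\<And>k. A k \<subseteq> {1 - 1 / 2 ^ N k .. 1 - 1 / 2 ^ N k / (2 :: real)}"
  shows "disjoint_family A"
proof -
  have less: "A k \<inter> A l = {}" if "k < l" for k l
  proof -
    have "N i \<le> N (Suc i)" for i using N[of i] by linarith
    then have "N (Suc k) \<le> N l" using lift_Suc_mono_le[of N "Suc k" l] that by simp
    then have "N k + 2 \<le> N l" using N[of k] by linarith
    then have "(2::real) ^ (N k + 2) \<le> 2 ^ N l" by (rule power_increasing) simp
    then have "1 / (2::real) ^ N l \<le> 1 / 2 ^ (N k + 2)" by (intro divide_left_mono) auto
    also have "\<dots> < 1 / 2 ^ N k / (2 :: real)" by (simp add: field_simps)
    finally show ?thesis using A[of k] A[of l] by fastforce
  qed
  show ?thesis
    unfolding disjoint_family_on_def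
    by (metis Int_commute less linorder_neqE_nat)
qed

theorem mainTheorem4:
  fixes n N :: "nat \<Rightarrow> nat" and \<alpha> :: "nat \<Rightarrow> real"
  assumes n_power: "\<forall>k\<ge>1. \<exists>m\<ge>1. n k = 2 ^ m"
    and n_increasing: "\<forall>k\<ge>1. n k < n (k + 1)"
    and n_growth: "\<forall>k\<ge>2. real (n k) powr (1/8) \<ge> 2 ^ (\<Sum>i=1..k-1. n i)"
    and N_eq: "\<forall>k. N k = (\<Sum>i=1..k. n i)"
    and \<alpha>_eq: "\<forall>k. \<alpha> k = 2 ^ n k * real (n k) powr (- 5/4)"
  shows "\<exists>J :: nat \<Rightarrow> nat set.
    (let B = (\<lambda>k. \<Union>j\<in>J k. dyadic (N k) j);
         f = (\<lambda>t. \<Sum>k. \<alpha> (Suc k) * indicator (B (Suc k)) t)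
     in (\<forall>k\<ge>1. J k \<subseteq> {1..2 ^ N k} \<and> card (J k) = n k) \<and>
        (\<forall>k\<ge>1. \<exists>l\<in>{1..2 ^ N (k - 1)}. \<forall>j\<in>J k. dyadic (N k) j \<subseteq> dyadic (N (k - 1)) l) \<and>
        (\<forall>k\<ge>1. orthogonal_matrix_on {N (k - 1)<..N k} (J k)
           (\<lambda>i j. real (n k) powr (- 1/2) * rademacher_sign (N k) i j)) \<and>
        (\<forall>k\<ge>1. \<forall>l\<ge>1. k \<noteq> l \<longrightarrow> negligible (B k \<inter> B l)) \<and>
        f \<in> mult_L1 \<and>
        f \<notin> sym_L1 \<and>
        (\<integral>\<^sup>+ t. ennreal (decr_rearr f t * (ln (exp 1 / t)) powr (1/2)) \<partial>m01) = \<infinity>)"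
proof -
  \<comment> \<open>Blocks are renumbered from 0: block \<open>k\<close> lies in the rightmost
    interval of rank \<open>N k\<close> and uses the next \<open>\<nu> k\<close> Rademacher
    functions.\<close>
  define \<nu> where "\<nu> k = n (Suc k)" for k
  have N_Suc: "N (Suc k) = N k + \<nu> k" for k by (simp add: N_eq \<nu>_def)
  have "\<forall>k. \<exists>m. m \<ge> 1 \<and> \<nu> k = 2 ^ m" using n_power by (simp add: \<nu>_def)
  then obtain \<mu> where \<mu>: "\<And>k. \<mu> k \<ge> 1" "\<And>k. \<nu> k = 2 ^ \<mu> k" by metis
  have \<nu>_ge_2: "2 \<le> \<nu> k" for k
    using power_increasing[OF \<mu>(1)[of k], of "2::nat"] \<mu>(2)[of k] by simp
  have \<nu>_pos: "1 \<le> \<nu> k" for k using \<nu>_ge_2[of k] by linarith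
  have N_step: "N k + 2 \<le> N (Suc k)" for k using N_Suc[of k] \<nu>_ge_2[of k] by linarith
  have k_le_N: "k \<le> N k" for k
  proof (induction k)
    case (Suc k)
    then show ?case using N_step[of k] by linarith
  qed simp
  have k_le_\<nu>: "k \<le> \<nu> k" for k
  proof (induction k)
    case (Suc k)
    then show ?case using n_increasing[rule_format, of "Suc k"] by (simp add: \<nu>_def)
  qed simp
  \<comment> \<open>For \<open>k = 0\<close> the left-hand side is 1; otherwise this is the growth
    hypothesis at the index \<open>Suc k\<close>, which is at least 2.\<close>
  have growth: "2 ^ N k \<le> real (\<nu> k) powr (1/8)" for k
  proof (cases k)
    case 0
    then show ?thesis using \<nu>_pos[of 0] by (simp add: N_eq ge_one_powr_ge_zero)
  next
    case (Suc l)
    then show ?thesis using n_growth[rule_format, of "Suc k"] by (simp add: N_eq \<nu>_def)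
  qed
  define \<beta> where "\<beta> k = \<alpha> (Suc k)" for k
  have \<beta>: "\<beta> k = 2 ^ \<nu> k * real (\<nu> k) powr (- 5/4)" for k by (simp add: \<beta>_def \<alpha>_eq \<nu>_def)
  have \<beta>_nonneg: "0 \<le> \<beta> k" for k by (simp add: \<beta>)
  \<comment> \<open>The blocks are chosen independently of one another; their location inside
    prescribed left halves makes them disjoint.\<close>
  have "\<forall>k. \<exists>J. J \<subseteq> {1..2 ^ (N k + \<nu> k)} \<and> card J = \<nu> k \<and>
    (\<forall>j\<in>J. dyadic (N k + \<nu> k) j \<subseteq> {1 - 1 / 2 ^ N k .. 1 - 1 / 2 ^ N k / 2}) \<and>
    orthogonal_matrix_on {N k<..N k + \<nu> k} J (\<lambda>i j. real (\<nu> k) powr (- 1/2) * rademacher_sign (N k + \<nu> k) i j)"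
  proof
    fix k
    show "\<exists>J. J \<subseteq> {1..2 ^ (N k + \<nu> k)} \<and> card J = \<nu> k \<and>
      (\<forall>j\<in>J. dyadic (N k + \<nu> k) j \<subseteq> {1 - 1 / 2 ^ N k .. 1 - 1 / 2 ^ N k / 2}) \<and>
      orthogonal_matrix_on {N k<..N k + \<nu> k} J (\<lambda>i j. real (\<nu> k) powr (- 1/2) * rademacher_sign (N k + \<nu> k) i j)"
      unfolding \<mu>(2) by (rule Hadamard_dyadic_columns[of "N k" "\<mu> k"]) blast
  qed
  then obtain I where I: "\<And>k. I k \<subseteq> {1..2 ^ (N k + \<nu> k)}" "\<And>k. card (I k) = \<nu> k"
      "\<And>k j. j \<in> I k \<Longrightarrow> dyadic (N k + \<nu> k) j \<subseteq> {1 - 1 / 2 ^ N k .. 1 - 1 / 2 ^ N k / 2}"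
      "\<And>k. orthogonal_matrix_on {N k<..N k + \<nu> k} (I k)
        (\<lambda>i j. real (\<nu> k) powr (- 1/2) * rademacher_sign (N k + \<nu> k) i j)"
    by metis
  have finI: "finite (I k)" for k using I(1) by (rule finite_subset) simp
  define B where "B k = (\<Union>j\<in>I k. dyadic (N k + \<nu> k) j)" for k
  define b where "b k = real (\<nu> k) / 2 ^ (N k + \<nu> k)" for k
  have gap01: "{1 - 1 / 2 ^ N k .. 1 - 1 / 2 ^ N k / 2} \<subseteq> {0..1 :: real}" for k
    using one_le_power[of "2::real" "N k"] by (auto simp: field_simps)
  have B_gap: "B k \<subseteq> {1 - 1 / 2 ^ N k .. 1 - 1 / 2 ^ N k / 2}" for k
    unfolding B_def using I(3) by blast
  have B_disj: "disjoint_family B" using N_step B_gap by (rule disjoint_family_gaps)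
  have B01: "B k \<subseteq> {0..1}" for k using B_gap gap01 by blast
  have B_borel: "B k \<in> sets borel" for k using finI by (auto simp: B_def dyadic_def)
  have B_measure: "measure m01 (B k) = b k" for k
    using measure_UN_dyadic[OF finI, of "N k + \<nu> k" k] measure_m01[OF B01 B_borel, of k]
    by (simp add: B_def b_def I(2))
  note est = \<nu>_pos growth
  have \<beta>b: "\<beta> k * b k = real (\<nu> k) powr (- 1/4) / 2 ^ N k" for k
    unfolding \<beta> b_def by (rule weight_eq[OF est])
  let ?f = "step_sum \<beta> B"

  \<comment> \<open>Membership of the function in the multiplicator space\<close>
  have f_mult: "?f \<in> mult_L1"
    unfolding mult_L1_def
  proof (intro CollectI conjI allI impI)
    show "?f \<in> borel_measurable m01" by (rule borel_measurable_step_sum[OF B_borel])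
    fix a x assume x: "rademacher_sum_L1 a x"
    obtain K where K: "K \<ge> 0" "\<And>m. (\<Sum>i=1..m. (a i)\<^sup>2) \<le> K"
      using rademacher_sum_L1_square_bounded[OF x] by metis
    show "integrable m01 (\<lambda>t. ?f t * x t)"
    proof (rule integrable_step_sum_mult[OF B_borel B_disj B01 \<beta>_nonneg rademacher_sum_L1_limit(1)[OF x]])
      fix k
      \<comment> \<open>The bound is the same for all late partial sums, so it passes to the L1
        limit \<open>x\<close>.\<close>
      have "(\<integral>t. indicator (B k) t * \<bar>rad_sum a m t\<bar> \<partial>m01) \<le> b k * ((1 + K * (2 * real (N k) + 3)) / 2)"
        if "N k + \<nu> k \<le> m" for m
        unfolding B_def b_def
        using I(1,2,4) K(2) that B01[of k, unfolded B_def] \<nu>_pos[of k]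
        by (intro integral_rad_sum_orthogonal_block) auto
      then have "(\<integral>t. indicator (B k) t * \<bar>x t\<bar> \<partial>m01) \<le> b k * ((1 + K * (2 * real (N k) + 3)) / 2)"
        by (intro LIMSEQ_le_const2[OF tendsto_integral_abs_rad_sum[OF x sets_m01_borel[OF B_borel B01]]]) blast
      then have "\<beta> k * (\<integral>t. indicator (B k) t * \<bar>x t\<bar> \<partial>m01) \<le> \<beta> k * (b k * ((1 + K * (2 * real (N k) + 3)) / 2))"
        using \<beta>_nonneg by (rule mult_left_mono)
      also have "\<dots> = real (\<nu> k) powr (- 1/4) / 2 ^ N k * ((1 + K * (2 * real (N k) + 3)) / 2)"
        by (simp only: \<beta>b mult.assoc[symmetric])
      also have "\<dots> \<le> 3 * (1 + K) / 4 ^ N k" by (rule upper_estimate[OF est K(1)])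
      \<comment> \<open>\<open>k \<le> N k\<close> yields a geometric majorant.\<close>
      also have "\<dots> \<le> 3 * (1 + K) / 4 ^ k"
        using K(1) k_le_N[of k] by (intro divide_left_mono power_increasing) auto
      finally show "\<beta> k * (\<integral>t. indicator (B k) t * \<bar>x t\<bar> \<partial>m01) \<le> 3 * (1 + K) * (1/4) ^ k"
        by (simp add: power_divide)
    next
      show "summable (\<lambda>k. 3 * (1 + K) * (1/4 :: real) ^ k)"
        by (intro summable_mult summable_geometric) simp
    qed
  qed

  \<comment> \<open>An equimeasurable function outside the multiplicator space\<close>
  define p where "p k = \<nu> k - \<mu> k" for k
  define D where "D k = dyadic (N k + p k) (2 ^ p k * (2 ^ N k - 1) + 1)" for k
  have \<mu>_le: "\<mu> k \<le> \<nu> k" for k by (simp add: \<mu>(2) less_imp_le)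
  have p: "real (\<nu> k) / 2 \<le> real (p k)" "p k \<le> \<nu> k" for k
    using half_le_diff_log[of "\<mu> k"] by (simp_all add: p_def \<mu>(2))
  have p_pos: "1 \<le> p k" for k using p(1)[of k] \<nu>_ge_2[of k] by linarith
  \<comment> \<open>Since \<open>\<nu> k\<close> is a power of 2, the measure of \<open>B k\<close>
    is that of one dyadic interval, of rank \<open>N k + p k\<close>.\<close>
  have b_eq: "b k = 1 / 2 ^ (N k + p k)" for k
  proof -
    have "N k + \<nu> k = \<mu> k + (N k + p k)" using \<mu>_le[of k] by (simp add: p_def)
    then have "(2::real) ^ (N k + \<nu> k) = 2 ^ \<mu> k * 2 ^ (N k + p k)" by (metis power_add)
    moreover have "real (\<nu> k) = 2 ^ \<mu> k" by (simp add: \<mu>(2))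
    ultimately show ?thesis unfolding b_def by simp
  qed
  \<comment> \<open>\<open>1 \<le> p k\<close> keeps \<open>D k\<close> in the same left half as
    \<open>B k\<close>, so the disjointness criterion applies again.\<close>
  have D_gap: "D k \<subseteq> {1 - 1 / 2 ^ N k .. 1 - 1 / 2 ^ N k / 2}" for k
  proof -
    have "(2::real) ^ (N k + 1) \<le> 2 ^ (N k + p k)" using p_pos[of k] by (intro power_increasing) auto
    then have "1 / (2::real) ^ (N k + p k) \<le> 1 / 2 ^ (N k + 1)" by (intro divide_left_mono) auto
    also have "\<dots> = 1 / 2 ^ N k / 2" by simp
    finally have "1 / (2::real) ^ (N k + p k) \<le> 1 / 2 ^ N k / 2" .
    moreover have "1 - u + v \<le> 1 - u / 2" if "v \<le> u / 2" for u v :: real using that by linarith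
    ultimately have "1 - 1 / 2 ^ N k + 1 / (2::real) ^ (N k + p k) \<le> 1 - 1 / 2 ^ N k / 2" by blast
    then show ?thesis unfolding D_def dyadic_after by (simp only: atLeastatMost_subset_iff order_refl simp_thms)
  qed
  have D_disj: "disjoint_family D" using N_step D_gap by (rule disjoint_family_gaps)
  have D01: "D k \<subseteq> {0..1}" for k using D_gap gap01 by blast
  have D_borel: "D k \<in> sets borel" for k by (simp add: D_def dyadic_def)
  have D_measure: "measure m01 (D k) = b k" for k
    using measure_m01[OF D01 D_borel, of k] by (simp add: D_def b_eq measure_dyadic)

  \<comment> \<open>The exponent makes the squares summable, as 6/5 > 1, while the block sums of
    order \<open>\<nu> k powr (2/5)\<close> still outgrow the weight loss
    \<open>\<nu> k powr (3/8)\<close>.\<close>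
  define a where "a i = real i powr (- 3/5)" for i
  have "(a i)\<^sup>2 = real i powr (- 6/5)" for i
    unfolding a_def power2_eq_square by (subst powr_add[symmetric]) simp
  then have "summable (\<lambda>i. (a i)\<^sup>2)" using summable_real_powr_iff[of "- 6/5"] by simp
  then obtain x where x: "rademacher_sum_L1 a x" using rademacher_sum_L1_exists by metis
  have lower: "real (\<nu> k) powr (1/40) / 4 - 1 \<le> \<beta> k * (\<integral>t. indicator (D k) t * \<bar>x t\<bar> \<partial>m01)" for k
  proof -
    define A where "A = (\<Sum>i\<in>{N k<..N k + p k}. a i) - (\<Sum>i=1..N k. \<bar>a i\<bar>)"
    have "b k * A \<le> (\<integral>t. indicator (D k) t * \<bar>rad_sum a m t\<bar> \<partial>m01)" if "N k + p k \<le> m" for m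
      using integral_rad_sum_dyadic_ge[OF that, of a] D01[of k] by (simp add: D_def b_eq A_def)
    then have "b k * A \<le> (\<integral>t. indicator (D k) t * \<bar>x t\<bar> \<partial>m01)"
      by (intro LIMSEQ_le_const[OF tendsto_integral_abs_rad_sum[OF x sets_m01_borel[OF D_borel D01]]]) blast
    then have "\<beta> k * (b k * A) \<le> \<beta> k * (\<integral>t. indicator (D k) t * \<bar>x t\<bar> \<partial>m01)"
      using \<beta>_nonneg by (rule mult_left_mono)
    moreover have "real (\<nu> k) powr (1/40) / 4 - 1 \<le> \<beta> k * (b k * A)"
      unfolding mult.assoc[symmetric] \<beta>b A_def a_def by (rule lower_estimate[OF est p])
    ultimately show ?thesis by linarith
  qed
  have "step_sum \<beta> D \<notin> mult_L1"
  proof (rule not_mult_L1I[OF D_borel D_disj D01 \<beta>_nonneg x])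
    fix C :: real
    obtain k where "4 * (C + 1) < real (\<nu> k) powr (1/40)"
      using powr_of_nat_unbounded[of \<nu> "1/40" "4 * (C + 1)"] k_le_\<nu> by auto
    then have "C < real (\<nu> k) powr (1/40) / 4 - 1" by simp
    from less_le_trans[OF this lower[of k]]
    show "\<exists>k. C < \<beta> k * (\<integral>t. indicator (D k) t * \<bar>x t\<bar> \<partial>m01)" by blast
  qed
  moreover have "equimeasurable ?f (step_sum \<beta> D)"
    by (rule equimeasurable_step_sum[OF B_borel B_disj B01 D_borel D_disj D01 \<beta>_nonneg])
       (simp add: B_measure D_measure)
  ultimately have f_sym: "?f \<notin> sym_L1" by (auto simp: sym_L1_def)

  \<comment> \<open>Divergence of the logarithmic integral of the rearrangement\<close>
  have f_int: "(\<integral>\<^sup>+ t. ennreal (decr_rearr ?f t * (ln (exp 1 / t)) powr (1/2)) \<partial>m01) = \<infinity>" (is "?V = _")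
  proof (rule ccontr)
    assume "?V \<noteq> \<infinity>"
    then obtain C where C: "?V = ennreal C" "0 \<le> C" by (cases ?V) auto
    \<comment> \<open>Block \<open>k\<close> alone contributes at least
      \<open>\<nu> k powr (1/8) / 2\<close>, which exceeds any finite value \<open>C\<close> of the
      integral for suitable \<open>k\<close>.\<close>
    obtain k where k: "2 * C < real (\<nu> k) powr (1/8)"
      using powr_of_nat_unbounded[of \<nu> "1/8" "2 * C"] k_le_\<nu> by auto
    have b: "0 < b k" "b k \<le> 1" using \<nu>_pos[of k] by (auto simp: b_eq)
    have "\<beta> k \<le> \<bar>?f t\<bar>" if "t \<in> B k" for t
      using step_sum_on[OF B_disj that, of \<beta>] by simp
    from nn_integral_decr_rearr_ge[OF borel_measurable_step_sum[OF B_borel] sets_m01_borel[OF B_borel B01] this B_measure b \<beta>_nonneg]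
    have "ennreal (\<beta> k * (ln (exp 1 / b k)) powr (1/2) * b k) \<le> ennreal C" by (simp only: C)
    then have "\<beta> k * (ln (exp 1 / b k)) powr (1/2) * b k \<le> C" using C(2) by (simp add: ennreal_le_iff)
    moreover have "real (\<nu> k) powr (1/8) / 2 \<le> \<beta> k * (ln (exp 1 / b k)) powr (1/2) * b k"
      unfolding \<beta> by (rule log_estimate[OF est \<mu>(2) b_def])
    ultimately show False using k by linarith
  qed

  \<comment> \<open>Back to the numbering of blocks from 1.\<close>
  define J where "J k = I (k - 1)" for k
  have f_eq: "(\<lambda>t. \<Sum>k. \<alpha> (Suc k) * indicator (\<Union>j\<in>J (Suc k). dyadic (N (Suc k)) j) t) = ?f"
    by (rule ext) (simp add: step_sum_def \<beta>_def J_def N_Suc B_def)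
  show ?thesis
    unfolding Let_def
  proof (intro exI[of _ J] conjI allI impI)
    fix k :: nat assume "k \<ge> 1"
    then obtain l where l: "k = Suc l" by (cases k) auto
    show "J k \<subseteq> {1..2 ^ N k}" "card (J k) = n k"
      using I(1,2)[of l] by (simp_all add: l J_def N_Suc \<nu>_def)
    show "orthogonal_matrix_on {N (k - 1)<..N k} (J k)
        (\<lambda>i j. real (n k) powr (- 1/2) * rademacher_sign (N k) i j)"
      using I(4)[of l] by (simp add: l J_def N_Suc \<nu>_def)
    show "\<exists>l\<in>{1..2 ^ N (k - 1)}. \<forall>j\<in>J k. dyadic (N k) j \<subseteq> dyadic (N (k - 1)) l"
    \<comment> \<open>The witness is the rightmost interval of rank
      \<open>N (k - 1)\<close>.\<close>
    proof (intro bexI[of _ "2 ^ N (k - 1)"] ballI)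
      fix j assume "j \<in> J k"
      then have "dyadic (N k) j \<subseteq> {1 - 1 / 2 ^ N l .. 1 - 1 / 2 ^ N l / 2}"
        using I(3)[of j l] by (simp add: l J_def N_Suc)
      moreover have "{1 - 1 / 2 ^ N l .. 1 - 1 / 2 ^ N l / 2} \<subseteq> dyadic (N l) (2 ^ N l)"
        by (auto simp: dyadic_def diff_divide_distrib intro: order_trans)
      ultimately show "dyadic (N k) j \<subseteq> dyadic (N (k - 1)) (2 ^ N (k - 1))" by (simp add: l)
    qed simp
    fix k' :: nat assume "k' \<ge> 1" "k \<noteq> k'"
    then obtain l' where l': "k' = Suc l'" by (cases k') auto
    have "B l \<inter> B l' = {}"
      using B_disj \<open>k \<noteq> k'\<close> by (auto simp: disjoint_family_on_def l l')
    then show "negligible ((\<Union>j\<in>J k. dyadic (N k) j) \<inter> (\<Union>j\<in>J k'. dyadic (N k') j))"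
      by (simp add: l l' J_def N_Suc B_def)
  qed (unfold f_eq, fact f_mult, fact f_sym, fact f_int)
qed

end
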